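(* Let $(X,G,\Phi)$ be a dynamical system, where $X$ is a compact totally disconnected Hausdorff space and $G$ is a finitely generated group. Let $S$ be a finite generator of $G$. Then $\Phi$ has the $S$-shadowing property if and only if $(X,G,\Phi)$ is conjugate to the inverse limit of an ML inverse system of shifts of finite type (over $G$).
   Context: $G$ is a countable discrete group with identity $e_G$. A finite set $S\subset G$ is a finite generator of $G$ if every $g\in G$ can be written $g=s_1\cdots s_n$ with $s_i\in S\cup S^{-1}$; $G$ is finitely generated if such $S$ exists. A dynamical system $(X,G,\Phi)$ consists of a compact Hausdorff space $X$ and $\Phi:G\times X\to X$ such that each $\Phi_g:=\Phi(g,\cdot)$ is a homeomorphism, $\Phi_{e_G}=\mathrm{id}_X$ and $\Phi_{gg'}=\Phi_g\circ\Phi_{g'}$. Shadowing. A finite open cover of $X$ never contains the empty set. Let $S\subset G$ and let $\mathcal U$ be a finite open cover of $X$. A family $\{x_g\}_{g\in G}$ in $X$ is an $(S,\mathcal U)$-pseudo-orbit if there is a family $\{U_g\}_{g\in G}$ in $\mathcal U$ such that $x_{sg},\Phi_s(x_g)\in U_{sg}$ for all $g\in G$, $s\in S$. A point $z\in X$ $\mathcal U$-shadows $\{x_g\}_{g\in G}$ if for each $g\in G$ there is $U_g\in\mathcal U$ with $\Phi_g(z),x_g\in U_g$. $\Phi$ has the $S$-shadowing property if for every finite open cover $\mathcal U$ of $X$ there is a finite open cover $\mathcal V$ of $X$ such that every $(S,\mathcal V)$-pseudo-orbit is $\mathcal U$-shadowed by some point of $X$. Subshifts. For a finite set $\Sigma$,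 $G$ acts on $\Sigma^G$ (product topology, $\Sigma$ discrete) by $\sigma_g(x)(h)=x(hg)$. A subshift is a closed $G$-invariant subset of some $\Sigma^G$, regarded as a dynamical system under $\sigma$. For $A\subset G$ and $P\in\Sigma^A$ let $C(P)=\{y\in\Sigma^G: y(g)=P(g)\ \forall g\in A\}$. A subshift $X\subset\Sigma^G$ is a shift of finite type if there are a finite $A\subset G$ and $\mathcal F\subset\Sigma^A$ with $X=\{x\in\Sigma^G:\sigma_g(x)\notin C(P)\text{ for all }g\in G,\ P\in\mathcal F\}$. Inverse limits. For a directed set $(\Lambda,\le)$, an inverse system $(\phi^\eta_\lambda,(X_\lambda,G,\Phi^\lambda))$ of dynamical systems consists of dynamical systems $(X_\lambda,G,\Phi^\lambda)$, $\lambda\in\Lambda$, and continuous (not necessarily surjective) maps $\phi^\eta_\lambda:X_\eta\to X_\lambda$ for $\lambda\le\eta$ with $\phi^\lambda_\lambda=\mathrm{id}$, $\phi^\gamma_\lambda=\phi^\eta_\lambda\circ\phi^\gamma_\eta$ for $\lambda\le\eta\le\gamma$, and $\Phi^\lambda_g\circ\phi^\eta_\lambda=\phi^\eta_\lambda\circ\Phi^\eta_g$ for all $g\in G$. Its inverse limit is the space of all $(x_\lambda)\in\prod_\lambda X_\lambda$ with $x_\lambda=\phi^\eta_\lambda(x_\eta)$ for all $\lambda\le\eta$, with the subspace topology and the coordinatewise $G$-action. It is an ML inverse system (satisfies the Mittag-Leffler condition) if for every $\lambda$ there is $\eta\ge\lambda$ such that $\phi^\gamma_\lambda(X_\gamma)=\phi^\eta_\lambda(X_\eta)$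 for all $\gamma\ge\eta$. Two systems are conjugate if there is a $G$-equivariant homeomorphism between them. *)

theory Defs
  imports "HOL-Analysis.Analysis" "HOL-Algebra.Generated_Groups"
begin

section \<open>Dynamical systems\<close>

text \<open>
  Groups are given by their carrier and spaces by an abstract topology, so that a space may be
  empty. An action is a curried map; its values off the carrier of the group and off the
  underlying space of the topology are irrelevant.
\<close>

definition finite_generator :: "('g, 'm) monoid_scheme \<Rightarrow> 'g set \<Rightarrow> bool" where
  "finite_generator G S \<longleftrightarrow> finite S \<and> S \<subseteq> carrier G \<and> generate G S = carrier G"

definition dynamical_system ::
    "('g, 'm) monoid_scheme \<Rightarrow> 'x topology \<Rightarrow> ('g \<Rightarrow> 'x \<Rightarrow> 'x) \<Rightarrow> bool" where
  "dynamical_system G X \<Phi> \<longleftrightarrow>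
     compact_space X \<and> Hausdorff_space X \<and>
     (\<forall>g\<in>carrier G. homeomorphic_map X X (\<Phi> g)) \<and>
     (\<forall>x\<in>topspace X. \<Phi> \<one>\<^bsub>G\<^esub> x = x) \<and>
     (\<forall>g\<in>carrier G. \<forall>g'\<in>carrier G. \<forall>x\<in>topspace X. \<Phi> (g \<otimes>\<^bsub>G\<^esub> g') x = \<Phi> g (\<Phi> g' x))"

definition conjugate_systems ::
    "('g, 'm) monoid_scheme \<Rightarrow> 'x topology \<Rightarrow> ('g \<Rightarrow> 'x \<Rightarrow> 'x)
      \<Rightarrow> 'y topology \<Rightarrow> ('g \<Rightarrow> 'y \<Rightarrow> 'y) \<Rightarrow> bool" where
  "conjugate_systems G X \<Phi> Y \<Psi> \<longleftrightarrow>
     (\<exists>h. homeomorphic_map X Y h \<and>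
          (\<forall>g\<in>carrier G. \<forall>x\<in>topspace X. h (\<Phi> g x) = \<Psi> g (h x)))"

definition totally_disconnected_space :: "'x topology \<Rightarrow> bool" where
  "totally_disconnected_space X \<longleftrightarrow> (\<forall>C. connectedin X C \<longrightarrow> (\<exists>a. C \<subseteq> {a}))"


section \<open>Shadowing\<close>

definition finite_open_cover :: "'x topology \<Rightarrow> 'x set set \<Rightarrow> bool" where
  "finite_open_cover X \<U> \<longleftrightarrow>
     finite \<U> \<and> (\<forall>U\<in>\<U>. openin X U \<and> U \<noteq> {}) \<and> \<Union>\<U> = topspace X"

definition pseudo_orbit ::
    "('g, 'm) monoid_scheme \<Rightarrow> 'x topology \<Rightarrow> ('g \<Rightarrow> 'x \<Rightarrow> 'x)
      \<Rightarrow> 'g set \<Rightarrow> 'x set set \<Rightarrow> ('g \<Rightarrow> 'x) \<Rightarrow> bool" where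
  "pseudo_orbit G X \<Phi> S \<U> x \<longleftrightarrow>
     (\<forall>g\<in>carrier G. x g \<in> topspace X) \<and>
     (\<exists>U. (\<forall>g\<in>carrier G. U g \<in> \<U>) \<and>
          (\<forall>g\<in>carrier G. \<forall>s\<in>S. x (s \<otimes>\<^bsub>G\<^esub> g) \<in> U (s \<otimes>\<^bsub>G\<^esub> g) \<and> \<Phi> s (x g) \<in> U (s \<otimes>\<^bsub>G\<^esub> g)))"

definition shadows ::
    "('g, 'm) monoid_scheme \<Rightarrow> ('g \<Rightarrow> 'x \<Rightarrow> 'x) \<Rightarrow> 'x set set \<Rightarrow> 'x \<Rightarrow> ('g \<Rightarrow> 'x) \<Rightarrow> bool" where
  "shadows G \<Phi> \<U> z x \<longleftrightarrow> (\<forall>g\<in>carrier G. \<exists>U\<in>\<U>. \<Phi> g z \<in> U \<and> x g \<in> U)"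

definition shadowing_property ::
    "('g, 'm) monoid_scheme \<Rightarrow> 'x topology \<Rightarrow> ('g \<Rightarrow> 'x \<Rightarrow> 'x) \<Rightarrow> 'g set \<Rightarrow> bool" where
  "shadowing_property G X \<Phi> S \<longleftrightarrow>
     (\<forall>\<U>. finite_open_cover X \<U> \<longrightarrow>
       (\<exists>\<V>. finite_open_cover X \<V> \<and>
         (\<forall>x. pseudo_orbit G X \<Phi> S \<V> x \<longrightarrow> (\<exists>z\<in>topspace X. shadows G \<Phi> \<U> z x))))"


section \<open>Subshifts\<close>

text \<open>
  Configurations are extensional functions on the carrier of the group, i.e. elements of
  \<open>carrier G \<rightarrow>\<^sub>E \<Sigma>\<close>, and similarly for patterns on a subset of the carrier.
\<close>

definition full_shift :: "('g, 'm) monoid_scheme \<Rightarrow> 'a set \<Rightarrow> ('g \<Rightarrow> 'a) topology" where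
  "full_shift G \<Sigma> = product_topology (\<lambda>_. discrete_topology \<Sigma>) (carrier G)"

definition shift_act :: "('g, 'm) monoid_scheme \<Rightarrow> 'g \<Rightarrow> ('g \<Rightarrow> 'a) \<Rightarrow> 'g \<Rightarrow> 'a" where
  "shift_act G g x = (\<lambda>h\<in>carrier G. x (h \<otimes>\<^bsub>G\<^esub> g))"

definition subshift :: "('g, 'm) monoid_scheme \<Rightarrow> 'a set \<Rightarrow> ('g \<Rightarrow> 'a) set \<Rightarrow> bool" where
  "subshift G \<Sigma> Y \<longleftrightarrow>
     finite \<Sigma> \<and> closedin (full_shift G \<Sigma>) Y \<and> (\<forall>g\<in>carrier G. \<forall>x\<in>Y. shift_act G g x \<in> Y)"

definition cylinder ::
    "('g, 'm) monoid_scheme \<Rightarrow> 'a set \<Rightarrow> 'g set \<Rightarrow> ('g \<Rightarrow> 'a) \<Rightarrow> ('g \<Rightarrow> 'a) set" where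
  "cylinder G \<Sigma> A P = {y \<in> carrier G \<rightarrow>\<^sub>E \<Sigma>. \<forall>g\<in>A. y g = P g}"

definition shift_of_finite_type ::
    "('g, 'm) monoid_scheme \<Rightarrow> 'a set \<Rightarrow> ('g \<Rightarrow> 'a) set \<Rightarrow> bool" where
  "shift_of_finite_type G \<Sigma> Y \<longleftrightarrow>
     subshift G \<Sigma> Y \<and>
     (\<exists>A \<F>. finite A \<and> A \<subseteq> carrier G \<and> \<F> \<subseteq> (A \<rightarrow>\<^sub>E \<Sigma>) \<and>
        Y = {x \<in> carrier G \<rightarrow>\<^sub>E \<Sigma>. \<forall>g\<in>carrier G. \<forall>P\<in>\<F>. shift_act G g x \<notin> cylinder G \<Sigma> A P})"

definition subshift_space ::
    "('g, 'm) monoid_scheme \<Rightarrow> 'a set \<Rightarrow> ('g \<Rightarrow> 'a) set \<Rightarrow> ('g \<Rightarrow> 'a) topology" where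
  "subshift_space G \<Sigma> Y = subtopology (full_shift G \<Sigma>) Y"


section \<open>Inverse systems\<close>

definition directed_index_set :: "'l set \<Rightarrow> ('l \<Rightarrow> 'l \<Rightarrow> bool) \<Rightarrow> bool" where
  "directed_index_set \<Lambda> leq \<longleftrightarrow>
     \<Lambda> \<noteq> {} \<and> (\<forall>i\<in>\<Lambda>. leq i i) \<and>
     (\<forall>i\<in>\<Lambda>. \<forall>j\<in>\<Lambda>. \<forall>k\<in>\<Lambda>. leq i j \<longrightarrow> leq j k \<longrightarrow> leq i k) \<and>
     (\<forall>i\<in>\<Lambda>. \<forall>j\<in>\<Lambda>. \<exists>k\<in>\<Lambda>. leq i k \<and> leq j k)"

text \<open>The bonding map \<open>\<phi> i j\<close>, for \<open>leq i j\<close>, goes from the space at \<open>j\<close> to the space at \<open>i\<close>.\<close>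

definition inverse_system ::
    "('g, 'm) monoid_scheme \<Rightarrow> 'l set \<Rightarrow> ('l \<Rightarrow> 'l \<Rightarrow> bool) \<Rightarrow> ('l \<Rightarrow> 'x topology)
      \<Rightarrow> ('l \<Rightarrow> 'g \<Rightarrow> 'x \<Rightarrow> 'x) \<Rightarrow> ('l \<Rightarrow> 'l \<Rightarrow> 'x \<Rightarrow> 'x) \<Rightarrow> bool" where
  "inverse_system G \<Lambda> leq X \<Phi> \<phi> \<longleftrightarrow>
     directed_index_set \<Lambda> leq \<and>
     (\<forall>i\<in>\<Lambda>. dynamical_system G (X i) (\<Phi> i)) \<and>
     (\<forall>i\<in>\<Lambda>. \<forall>j\<in>\<Lambda>. leq i j \<longrightarrow> continuous_map (X j) (X i) (\<phi> i j)) \<and>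
     (\<forall>i\<in>\<Lambda>. \<forall>x\<in>topspace (X i). \<phi> i i x = x) \<and>
     (\<forall>i\<in>\<Lambda>. \<forall>j\<in>\<Lambda>. \<forall>k\<in>\<Lambda>. leq i j \<longrightarrow> leq j k \<longrightarrow>
        (\<forall>x\<in>topspace (X k). \<phi> i k x = \<phi> i j (\<phi> j k x))) \<and>
     (\<forall>i\<in>\<Lambda>. \<forall>j\<in>\<Lambda>. leq i j \<longrightarrow>
        (\<forall>g\<in>carrier G. \<forall>x\<in>topspace (X j). \<Phi> i g (\<phi> i j x) = \<phi> i j (\<Phi> j g x)))"

definition mittag_leffler ::
    "'l set \<Rightarrow> ('l \<Rightarrow> 'l \<Rightarrow> bool) \<Rightarrow> ('l \<Rightarrow> 'x topology) \<Rightarrow> ('l \<Rightarrow> 'l \<Rightarrow> 'x \<Rightarrow> 'x) \<Rightarrow> bool" where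
  "mittag_leffler \<Lambda> leq X \<phi> \<longleftrightarrow>
     (\<forall>i\<in>\<Lambda>. \<exists>j\<in>\<Lambda>. leq i j \<and>
        (\<forall>k\<in>\<Lambda>. leq j k \<longrightarrow> \<phi> i k ` topspace (X k) = \<phi> i j ` topspace (X j)))"

definition inverse_limit_space ::
    "'l set \<Rightarrow> ('l \<Rightarrow> 'l \<Rightarrow> bool) \<Rightarrow> ('l \<Rightarrow> 'x topology) \<Rightarrow> ('l \<Rightarrow> 'l \<Rightarrow> 'x \<Rightarrow> 'x)
      \<Rightarrow> ('l \<Rightarrow> 'x) topology" where
  "inverse_limit_space \<Lambda> leq X \<phi> =
     subtopology (product_topology X \<Lambda>)
       {x \<in> (\<Pi>\<^sub>E i\<in>\<Lambda>. topspace (X i)). \<forall>i\<in>\<Lambda>. \<forall>j\<in>\<Lambda>. leq i j \<longrightarrow> x i = \<phi> i j (x j)}"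

definition inverse_limit_act ::
    "'l set \<Rightarrow> ('l \<Rightarrow> 'g \<Rightarrow> 'x \<Rightarrow> 'x) \<Rightarrow> 'g \<Rightarrow> ('l \<Rightarrow> 'x) \<Rightarrow> 'l \<Rightarrow> 'x" where
  "inverse_limit_act \<Lambda> \<Phi> g x = (\<lambda>i\<in>\<Lambda>. \<Phi> i g (x i))"

text \<open>
  The system at index \<open>i\<close> is the shift of finite type \<open>Y i\<close> over the finite alphabet \<open>\<Sigma> i\<close>;
  the alphabets at different indices are unrelated subsets of one type.
\<close>

definition SFT_ML_inverse_system ::
    "('g, 'm) monoid_scheme \<Rightarrow> 'l set \<Rightarrow> ('l \<Rightarrow> 'l \<Rightarrow> bool) \<Rightarrow> ('l \<Rightarrow> 'a set)
      \<Rightarrow> ('l \<Rightarrow> ('g \<Rightarrow> 'a) set) \<Rightarrow> ('l \<Rightarrow> 'l \<Rightarrow> ('g \<Rightarrow> 'a) \<Rightarrow> 'g \<Rightarrow> 'a) \<Rightarrow> bool" where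
  "SFT_ML_inverse_system G \<Lambda> leq \<Sigma> Y \<phi> \<longleftrightarrow>
     (\<forall>i\<in>\<Lambda>. shift_of_finite_type G (\<Sigma> i) (Y i)) \<and>
     inverse_system G \<Lambda> leq (\<lambda>i. subshift_space G (\<Sigma> i) (Y i)) (\<lambda>_. shift_act G) \<phi> \<and>
     mittag_leffler \<Lambda> leq (\<lambda>i. subshift_space G (\<Sigma> i) (Y i)) \<phi>"

text \<open>
  HOL cannot quantify existentially over the type \<open>'l\<close> of indices or the type \<open>'a\<close> of letters,
  so both are parameters of the following predicate, fixed through its two type arguments.
  For systems on a space over \<open>'x\<close>, indices in \<open>'x set set\<close> (room for the finite clopen partitions
  of the space) and letters in \<open>nat\<close> suffice for the existence of such a presentation; that a
  presentation implies a property can be stated for arbitrary \<open>'l\<close> and \<open>'a\<close>.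
\<close>

definition conjugate_to_ML_limit_of_SFTs ::
    "'l itself \<Rightarrow> 'a itself \<Rightarrow> ('g, 'm) monoid_scheme \<Rightarrow> 'x topology \<Rightarrow> ('g \<Rightarrow> 'x \<Rightarrow> 'x) \<Rightarrow> bool" where
  "conjugate_to_ML_limit_of_SFTs (_ :: 'l itself) (_ :: 'a itself) G X \<Phi> \<longleftrightarrow>
     (\<exists>(\<Lambda> :: 'l set) leq (\<Sigma> :: 'l \<Rightarrow> 'a set) Y \<phi>.
        SFT_ML_inverse_system G \<Lambda> leq \<Sigma> Y \<phi> \<and>
        conjugate_systems G X \<Phi>
          (inverse_limit_space \<Lambda> leq (\<lambda>i. subshift_space G (\<Sigma> i) (Y i)) \<phi>)
          (inverse_limit_act \<Lambda> (\<lambda>_. shift_act G)))"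

end

theory Submission
  imports Defs
begin

text \<open>
  Fix a locally constant map \<open>q\<close> on \<open>X\<close> and consider the shift of finite type of those configurations
  \<open>u\<close> in which every transition from \<open>u g\<close> to \<open>u (s g)\<close>, for a generator \<open>s\<close>, is realised by some
  point of \<open>X\<close>. As \<open>q\<close> runs through the codings by finite sets of clopen sets, these shifts form an
  inverse system by recoding. Their configurations are coded pseudo-orbits, while those coming from
  \<open>X\<close> are coded orbits. Shadowing says that the image of a sufficiently fine shift in a coarse one
  consists of itineraries of points only. This gives the Mittag-Leffler condition, and by compactness
  it also makes the map from \<open>X\<close> to the inverse limit surjective.

  Conversely, an open cover of the limit is resolved by a finite window at one index \<open>i\<close>; let \<open>j\<close> be
  an index at which the images in the shift at \<open>i\<close> are stable. A fine pseudo-orbit in the limit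
  projects to a family \<open>y g\<close> of configurations at \<open>j\<close>, and the diagonal configuration
  \<open>g \<mapsto> y g \<one>\<close> avoids the finitely many forbidden patterns. Its image at \<open>i\<close> lifts to the
  limit by stability, and the lift shadows the pseudo-orbit.
\<close>

section \<open>Locally constant maps on compact spaces\<close>

text \<open>By directedness every finite intersection contains a member of the family and so is
  nonempty; compactness does the rest. This form serves fibres of locally constant maps, threads of
  inverse systems and itineraries alike.\<close>

lemma directed_closed_Inter_nonempty:
  assumes "compact_space X" and "I \<noteq> {}"
    and clo: "\<And>i. i \<in> I \<Longrightarrow> closedin X (C i)"
    and ne: "\<And>i. i \<in> I \<Longrightarrow> C i \<noteq> {}"
    and dir: "\<And>i j. i \<in> I \<Longrightarrow> j \<in> I \<Longrightarrow> \<exists>k\<in>I. C k \<subseteq> C i \<inter> C j"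
  shows "\<exists>x\<in>topspace X. \<forall>i\<in>I. x \<in> C i"
proof -
  have "\<exists>k\<in>I. C k \<subseteq> \<Inter>(C ` J)" if "finite J" "J \<subseteq> I" for J
    using that
  proof (induction J rule: finite_induct)
    case empty
    then show ?case using \<open>I \<noteq> {}\<close> by auto
  next
    case (insert j J)
    then obtain k where "k \<in> I" "C k \<subseteq> \<Inter>(C ` J)" by auto
    moreover obtain l where "l \<in> I" "C l \<subseteq> C k \<inter> C j"
      using dir \<open>k \<in> I\<close> insert.prems by blast
    ultimately show ?case by auto
  qed
  then have "\<Inter>\<F> \<noteq> {}" if "finite \<F>" "\<F> \<subseteq> C ` I" for \<F>
    using that ne by (metis bot.extremum_uniqueI finite_subset_image)
  then have "\<Inter>(C ` I) \<noteq> {}"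
    using assms(1)[unfolded compact_space_fip, rule_format, of "C ` I"] clo by auto
  then obtain x where "\<forall>i\<in>I. x \<in> C i" by auto
  then show ?thesis
    using \<open>I \<noteq> {}\<close> clo closedin_subset by (metis all_not_in_conv subsetD)
qed

text \<open>Maps into \<open>discrete_topology UNIV\<close> are the locally constant ones. The
  universal codomain avoids tracking alphabets when coordinates, codes and truth values are treated
  alike.\<close>

lemma continuous_map_discrete_iff:
  "continuous_map X (discrete_topology UNIV) f \<longleftrightarrow>
     (\<forall>x\<in>topspace X. openin X {y \<in> topspace X. f y = f x})"
proof
  assume L: "continuous_map X (discrete_topology UNIV) f"
  show "\<forall>x\<in>topspace X. openin X {y \<in> topspace X. f y = f x}"
    using openin_continuous_map_preimage[OF L, of "{f x}" for x] by simp
next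
  assume R: "\<forall>x\<in>topspace X. openin X {y \<in> topspace X. f y = f x}"
  show "continuous_map X (discrete_topology UNIV) f"
    unfolding continuous_map_def
  proof (intro conjI allI impI)
    fix U
    have "{x \<in> topspace X. f x \<in> U}
        = \<Union>((\<lambda>x. {y \<in> topspace X. f y = f x}) ` {x \<in> topspace X. f x \<in> U})" by auto
    also have "openin X \<dots>" using R by blast
    finally show "openin X {x \<in> topspace X. f x \<in> U}" .
  qed auto
qed

lemma closedin_level_set:
  assumes "continuous_map X (discrete_topology UNIV) f"
  shows "closedin X {y \<in> topspace X. f y = c}"
  using closedin_continuous_map_preimage[OF assms, of "{c}"] by simp

lemma openin_level_set:
  assumes "continuous_map X (discrete_topology UNIV) f"
  shows "openin X {y \<in> topspace X. f y = c}"
  using openin_continuous_map_preimage[OF assms, of "{c}"] by simp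

lemma finite_image_continuous_map_discrete:
  assumes "compact_space X" "continuous_map X (discrete_topology UNIV) f"
  shows "finite (f ` topspace X)"
  using image_compactin[OF _ assms(2)] assms(1)
  by (auto simp: compactin_discrete_topology compact_space_def)

text \<open>Each fibre of \<open>p\<close> is a union of fibres of \<open>f\<close>, which are open.
  In this form the factoring map need not be named.\<close>

lemma continuous_map_discrete_factor:
  assumes "continuous_map X (discrete_topology UNIV) f"
    and "\<And>x y. x \<in> topspace X \<Longrightarrow> y \<in> topspace X \<Longrightarrow> f x = f y \<Longrightarrow> p x = p y"
  shows "continuous_map X (discrete_topology UNIV) p"
  unfolding continuous_map_discrete_iff
proof
  fix x assume x: "x \<in> topspace X"
  have "{y \<in> topspace X. p y = p x}
      = \<Union>((\<lambda>z. {y \<in> topspace X. f y = f z}) ` {z \<in> topspace X. p z = p x})"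
    (is "?L = ?R")
  proof
    show "?L \<subseteq> ?R" by blast
    show "?R \<subseteq> ?L"
    proof
      fix y assume "y \<in> ?R"
      then obtain z where "z \<in> topspace X" "p z = p x" "y \<in> topspace X" "f y = f z" by blast
      then show "y \<in> ?L" using assms(2)[of y z] by simp
    qed
  qed
  also have "openin X \<dots>"
    using openin_level_set[OF assms(1)] by blast
  finally show "openin X {y \<in> topspace X. p y = p x}" .
qed

text \<open>Fibres are finite intersections of open fibres. \<open>restrict\<close> turns agreement
  on \<open>F\<close> into equality of values, which makes reading a finite window a locally
  constant map.\<close>

lemma continuous_map_discrete_restrict:
  assumes "finite F" and "\<And>s. s \<in> F \<Longrightarrow> continuous_map X (discrete_topology UNIV) (\<lambda>x. p x s)"
  shows "continuous_map X (discrete_topology UNIV) (\<lambda>x. restrict (p x) F)"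
  unfolding continuous_map_discrete_iff
proof
  fix x assume x: "x \<in> topspace X"
  have "openin X (topspace X \<inter> (\<Inter>s\<in>F. {y \<in> topspace X. p y s = p x s}))"
  proof (cases "F = {}")
    case False
    then show ?thesis
      using assms(1) openin_level_set[OF assms(2)] by (intro openin_Int openin_INT2) auto
  qed simp
  also have "topspace X \<inter> (\<Inter>s\<in>F. {y \<in> topspace X. p y s = p x s})
      = {y \<in> topspace X. restrict (p y) F = restrict (p x) F}"
    by (auto simp: fun_eq_iff restrict_def)
  finally show "openin X {y \<in> topspace X. restrict (p y) F = restrict (p x) F}" .
qed

text \<open>
  The uniformity of a compact space is generated by any directed family of locally constant maps
  that separates points.
\<close>

lemma level_sets_refine_cover:
  assumes "compact_space X" and "I \<noteq> {}"
    and cont: "\<And>i. i \<in> I \<Longrightarrow> continuous_map X (discrete_topology UNIV) (q i)"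
    and dir: "\<And>i j. i \<in> I \<Longrightarrow> j \<in> I \<Longrightarrow> \<exists>k\<in>I. \<forall>x\<in>topspace X. \<forall>y\<in>topspace X.
                 q k x = q k y \<longrightarrow> q i x = q i y \<and> q j x = q j y"
    and sep: "\<And>x y. x \<in> topspace X \<Longrightarrow> y \<in> topspace X \<Longrightarrow> x \<noteq> y \<Longrightarrow> \<exists>i\<in>I. q i x \<noteq> q i y"
    and cov: "\<And>x. x \<in> topspace X \<Longrightarrow> \<exists>U\<in>\<U>. x \<in> U \<and> openin X U"
  shows "\<exists>i\<in>I. \<forall>x\<in>topspace X. \<exists>U\<in>\<U>. \<forall>y\<in>topspace X. q i y = q i x \<longrightarrow> y \<in> U"
proof -
  have "\<exists>i\<in>I. \<exists>U\<in>\<U>. \<forall>y\<in>topspace X. q i y = q i x \<longrightarrow> y \<in> U" if x: "x \<in> topspace X" for x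
  proof (rule ccontr)
    assume neg: "\<not> ?thesis"
    obtain U where U: "U \<in> \<U>" "x \<in> U" "openin X U" using cov x by blast
    \<comment> \<open>If no index isolates \<open>x\<close> inside \<open>U\<close>, the points
      outside \<open>U\<close> with the same value as \<open>x\<close> form a nonempty directed
      family of closed sets. A common point would differ from \<open>x\<close> without ever being
      separated from it.\<close>
    define C where "C i = {y \<in> topspace X. q i y = q i x} \<inter> (topspace X - U)" for i
    have "\<exists>y\<in>topspace X. \<forall>i\<in>I. y \<in> C i"
    proof (rule directed_closed_Inter_nonempty[OF assms(1,2)])
      show "closedin X (C i)" if "i \<in> I" for i
        unfolding C_def using closedin_level_set[OF cont[OF that]] U by blast
      show "C i \<noteq> {}" if "i \<in> I" for i
        using neg that U unfolding C_def by blast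
      show "\<exists>k\<in>I. C k \<subseteq> C i \<inter> C j" if "i \<in> I" "j \<in> I" for i j
        using dir[OF that] x unfolding C_def by blast
    qed
    then obtain y where "y \<in> topspace X" "\<forall>i\<in>I. q i y = q i x" "y \<notin> U"
      unfolding C_def using \<open>I \<noteq> {}\<close> by blast
    then show False using sep[of y x] x U by metis
  qed
  then obtain r where r: "\<And>x. x \<in> topspace X \<Longrightarrow> r x \<in> I"
      "\<And>x. x \<in> topspace X \<Longrightarrow> \<exists>U\<in>\<U>. \<forall>y\<in>topspace X. q (r x) y = q (r x) x \<longrightarrow> y \<in> U"
    by metis
  define N where "N x = {y \<in> topspace X. q (r x) y = q (r x) x}" for x
  have "\<forall>V\<in>N ` topspace X. openin X V" "topspace X \<subseteq> \<Union>(N ` topspace X)"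
    using openin_level_set[OF cont[OF r(1)]] unfolding N_def by auto
  then obtain \<F> where \<F>: "finite \<F>" "\<F> \<subseteq> N ` topspace X" "topspace X \<subseteq> \<Union>\<F>"
    using assms(1) unfolding compact_space_alt by meson
  then obtain K where K: "finite K" "K \<subseteq> topspace X" "\<F> = N ` K"
    by (meson finite_subset_image)
  \<comment> \<open>Directedness absorbs the finitely many local indices \<open>r z\<close> into one
    \<open>k\<close>; the fibre of \<open>q k\<close> through a point of \<open>N z\<close> then
    stays inside \<open>N z\<close>.\<close>
  have "\<exists>k\<in>I. \<forall>z\<in>K. \<forall>x\<in>topspace X. \<forall>y\<in>topspace X. q k x = q k y \<longrightarrow> q (r z) x = q (r z) y"
    using K(1,2)
  proof (induction K rule: finite_induct)
    case empty
    then show ?case using \<open>I \<noteq> {}\<close> by auto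
  next
    case (insert z K)
    then obtain k where k: "k \<in> I" "\<forall>z\<in>K. \<forall>x\<in>topspace X. \<forall>y\<in>topspace X.
        q k x = q k y \<longrightarrow> q (r z) x = q (r z) y" by auto
    obtain l where "l \<in> I" "\<forall>x\<in>topspace X. \<forall>y\<in>topspace X.
        q l x = q l y \<longrightarrow> q k x = q k y \<and> q (r z) x = q (r z) y"
      using dir[OF k(1) r(1)[of z]] insert.prems by auto
    then show ?case using k(2) by (intro bexI[of _ l]) (metis insert_iff)
  qed
  then obtain k where k: "k \<in> I" "\<And>z x y. z \<in> K \<Longrightarrow> x \<in> topspace X \<Longrightarrow> y \<in> topspace X \<Longrightarrow>
      q k x = q k y \<Longrightarrow> q (r z) x = q (r z) y" by blast
  have "\<exists>U\<in>\<U>. \<forall>y\<in>topspace X. q k y = q k x \<longrightarrow> y \<in> U" if x: "x \<in> topspace X" for x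
  proof -
    obtain z where z: "z \<in> K" "x \<in> N z" using \<F>(3) K(3) x by auto
    then obtain U where "U \<in> \<U>" "\<forall>y\<in>topspace X. q (r z) y = q (r z) z \<longrightarrow> y \<in> U"
      using r(2) K(2) by blast
    moreover have "q (r z) y = q (r z) z" if "y \<in> topspace X" "q k y = q k x" for y
      using k(2)[OF z(1) that(1) x that(2)] z(2) unfolding N_def by simp
    ultimately show ?thesis by blast
  qed
  then show ?thesis using k(1) by blast
qed

text \<open>The fibres of \<open>p\<close> form an open cover, and a fibre of \<open>q i\<close>
  inside a fibre of \<open>p\<close> forces equal values of \<open>p\<close>.\<close>

lemma locally_constant_factor:
  assumes "compact_space X" and "I \<noteq> {}"
    and "\<And>i. i \<in> I \<Longrightarrow> continuous_map X (discrete_topology UNIV) (q i)"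
    and "\<And>i j. i \<in> I \<Longrightarrow> j \<in> I \<Longrightarrow> \<exists>k\<in>I. \<forall>x\<in>topspace X. \<forall>y\<in>topspace X.
                 q k x = q k y \<longrightarrow> q i x = q i y \<and> q j x = q j y"
    and "\<And>x y. x \<in> topspace X \<Longrightarrow> y \<in> topspace X \<Longrightarrow> x \<noteq> y \<Longrightarrow> \<exists>i\<in>I. q i x \<noteq> q i y"
    and p: "continuous_map X (discrete_topology UNIV) p"
  shows "\<exists>i\<in>I. \<forall>x\<in>topspace X. \<forall>y\<in>topspace X. q i x = q i y \<longrightarrow> p x = p y"
proof -
  have "\<exists>i\<in>I. \<forall>x\<in>topspace X. \<exists>U\<in>range (\<lambda>c. {y \<in> topspace X. p y = c}).
      \<forall>y\<in>topspace X. q i y = q i x \<longrightarrow> y \<in> U"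
    by (rule level_sets_refine_cover[OF assms(1-5)]) (use openin_level_set[OF p] in auto)
  then obtain i where i: "i \<in> I" and
    *: "\<And>x. x \<in> topspace X \<Longrightarrow> \<exists>c. \<forall>y\<in>topspace X. q i y = q i x \<longrightarrow> p y = c" by fastforce
  show ?thesis
  proof (intro bexI[OF _ i] ballI impI)
    show "p x = p y" if "x \<in> topspace X" "y \<in> topspace X" "q i x = q i y" for x y
      using *[OF that(1)] that by metis
  qed
qed

lemma finite_open_cover_level_sets:
  assumes "compact_space X" "continuous_map X (discrete_topology UNIV) p"
  shows "finite_open_cover X ((\<lambda>x. {y \<in> topspace X. p y = p x}) ` topspace X)"
proof -
  have "(\<lambda>x. {y \<in> topspace X. p y = p x}) ` topspace X
      = (\<lambda>c. {y \<in> topspace X. p y = c}) ` p ` topspace X" by auto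
  then have "finite ((\<lambda>x. {y \<in> topspace X. p y = p x}) ` topspace X)"
    using finite_image_continuous_map_discrete[OF assms] by auto
  then show ?thesis
    using openin_level_set[OF assms(2)] unfolding finite_open_cover_def by auto
qed

text \<open>Points that no clopen set separates share a quasi-component. In a compact Hausdorff
  space this is a connected component, hence here a single point.\<close>

lemma clopen_separation:
  assumes "compact_space X" "Hausdorff_space X" "totally_disconnected_space X"
    and "x \<in> topspace X" "y \<in> topspace X" "x \<noteq> y"
  shows "\<exists>T. openin X T \<and> closedin X T \<and> x \<in> T \<and> y \<notin> T"
proof (rule ccontr)
  assume "\<not> ?thesis"
  then have "quasi_component_of X x y"
    unfolding quasi_component_of using assms by auto
  then have "connected_component_of X x y"
    using quasi_eq_connected_component_of[of X x] assms by simp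
  then show False
    using assms unfolding connected_component_of_def totally_disconnected_space_def by blast
qed


section \<open>Subshifts as dynamical systems\<close>

lemma subshift_subset:
  assumes "subshift G \<Sigma> Y"
  shows "Y \<subseteq> carrier G \<rightarrow>\<^sub>E \<Sigma>"
  using assms closedin_subset unfolding subshift_def full_shift_def by fastforce

lemma topspace_subshift_space [simp]:
  assumes "subshift G \<Sigma> Y"
  shows "topspace (subshift_space G \<Sigma> Y) = Y"
  using subshift_subset[OF assms] unfolding subshift_space_def full_shift_def by auto

lemma compact_subshift_space:
  assumes "subshift G \<Sigma> Y"
  shows "compact_space (subshift_space G \<Sigma> Y)"
proof -
  have "compact_space (full_shift G \<Sigma>)"
    using assms unfolding subshift_def full_shift_def
    by (simp add: compact_space_product_topology compact_space_discrete_topology)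
  then show ?thesis
    using assms unfolding subshift_def subshift_space_def
    by (simp add: closedin_compact_space compact_space_subtopology)
qed

lemma Hausdorff_subshift_space: "Hausdorff_space (subshift_space G \<Sigma> Y)"
  unfolding subshift_space_def full_shift_def
  by (simp add: Hausdorff_space_subtopology Hausdorff_space_product_topology
      Hausdorff_space_discrete_topology)

lemma continuous_map_subshift_coordinate:
  assumes "subshift G \<Sigma> Y" "g \<in> carrier G"
  shows "continuous_map (subshift_space G \<Sigma> Y) (discrete_topology UNIV) (\<lambda>y. y g)"
proof -
  have "continuous_map (subshift_space G \<Sigma> Y) (discrete_topology \<Sigma>) (\<lambda>y. y g)"
    unfolding subshift_space_def full_shift_def
    using assms(2) by (intro continuous_map_from_subtopology continuous_map_product_projection)
  then show ?thesis
    by (auto simp: continuous_map_def Pi_iff)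
      (metis (no_types, lifting) Collect_cong Int_iff inf_le2)
qed

lemma continuous_map_into_subshift:
  assumes Y: "subshift G \<Sigma> Y" and f: "\<And>z. z \<in> topspace Z \<Longrightarrow> f z \<in> Y"
    and c: "\<And>g. g \<in> carrier G \<Longrightarrow> continuous_map Z (discrete_topology UNIV) (\<lambda>z. f z g)"
  shows "continuous_map Z (subshift_space G \<Sigma> Y) f"
proof -
  have "f ` topspace Z \<subseteq> extensional (carrier G)"
    using f subshift_subset[OF Y] by (auto simp: PiE_def)
  moreover have "continuous_map Z (discrete_topology \<Sigma>) (\<lambda>z. f z g)" if "g \<in> carrier G" for g
    using c[OF that] f subshift_subset[OF Y] that by (fastforce simp: continuous_map_def PiE_iff)
  ultimately show ?thesis
    unfolding subshift_space_def full_shift_def continuous_map_in_subtopology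
      continuous_map_componentwise using f by auto
qed

lemma shift_act_mult:
  assumes "group G" "g \<in> carrier G" "g' \<in> carrier G"
  shows "shift_act G (g \<otimes>\<^bsub>G\<^esub> g') x = shift_act G g (shift_act G g' x)"
proof -
  interpret group G by fact
  show ?thesis using assms(2,3) by (auto simp: shift_act_def m_assoc)
qed

lemma shift_act_one:
  assumes "group G" "x \<in> extensional (carrier G)"
  shows "shift_act G \<one>\<^bsub>G\<^esub> x = x"
proof -
  interpret group G by fact
  show ?thesis using assms(2) by (auto simp: shift_act_def extensional_def)
qed

lemma continuous_map_shift_act:
  assumes "group G" "subshift G \<Sigma> Y" "g \<in> carrier G"
  shows "continuous_map (subshift_space G \<Sigma> Y) (subshift_space G \<Sigma> Y) (shift_act G g)"
proof (rule continuous_map_into_subshift[OF assms(2)])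
  interpret group G by fact
  show "shift_act G g z \<in> Y" if "z \<in> topspace (subshift_space G \<Sigma> Y)" for z
    using that assms(2,3) by (simp add: subshift_def)
  show "continuous_map (subshift_space G \<Sigma> Y) (discrete_topology UNIV) (\<lambda>z. shift_act G g z h)"
    if "h \<in> carrier G" for h
    using continuous_map_subshift_coordinate[OF assms(2), of "h \<otimes>\<^bsub>G\<^esub> g"] that assms(3)
    by (simp add: shift_act_def)
qed

lemma dynamical_system_subshift:
  assumes "group G" "subshift G \<Sigma> Y"
  shows "dynamical_system G (subshift_space G \<Sigma> Y) (shift_act G)"
proof -
  interpret group G by fact
  have ext: "y \<in> extensional (carrier G)" if "y \<in> Y" for y
    using that subshift_subset[OF assms(2)] by (auto simp: PiE_def)
  have "homeomorphic_map (subshift_space G \<Sigma> Y) (subshift_space G \<Sigma> Y) (shift_act G g)"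
    if g: "g \<in> carrier G" for g
  proof (rule homeomorphic_maps_imp_map)
    show "homeomorphic_maps (subshift_space G \<Sigma> Y) (subshift_space G \<Sigma> Y)
        (shift_act G g) (shift_act G (inv\<^bsub>G\<^esub> g))"
      unfolding homeomorphic_maps_def
      using g assms ext
      by (auto simp: continuous_map_shift_act shift_act_one simp flip: shift_act_mult)
  qed
  then show ?thesis
    unfolding dynamical_system_def
    using assms ext by (auto simp: compact_subshift_space Hausdorff_subshift_space
        shift_act_one shift_act_mult)
qed

text \<open>Restrictions to finite windows form a directed family of locally constant maps
  separating configurations, so every locally constant map factors through one of them.\<close>

lemma subshift_windows:
  assumes "subshift G \<Sigma> Y" and p: "continuous_map (subshift_space G \<Sigma> Y) (discrete_topology UNIV) p"
  shows "\<exists>F. finite F \<and> F \<subseteq> carrier G \<and>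
           (\<forall>x\<in>Y. \<forall>y\<in>Y. (\<forall>g\<in>F. x g = y g) \<longrightarrow> p x = p y)"
proof -
  let ?Z = "subshift_space G \<Sigma> Y" and ?I = "{F. finite F \<and> F \<subseteq> carrier G}"
  have ext: "y \<in> extensional (carrier G)" if "y \<in> Y" for y
    using that subshift_subset[OF assms(1)] by (auto simp: PiE_def)
  have "\<exists>F\<in>?I. \<forall>x\<in>topspace ?Z. \<forall>y\<in>topspace ?Z. restrict x F = restrict y F \<longrightarrow> p x = p y"
  proof (rule locally_constant_factor[OF compact_subshift_space[OF assms(1)] _ _ _ _ p])
    show "?I \<noteq> {}" by blast
    show "continuous_map ?Z (discrete_topology UNIV) (\<lambda>y. restrict y F)" if "F \<in> ?I" for F
      using that continuous_map_subshift_coordinate[OF assms(1)]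
      by (intro continuous_map_discrete_restrict) auto
    show "\<exists>K\<in>?I. \<forall>x\<in>topspace ?Z. \<forall>y\<in>topspace ?Z. restrict x K = restrict y K \<longrightarrow>
        restrict x F = restrict y F \<and> restrict x F' = restrict y F'"
      if "F \<in> ?I" "F' \<in> ?I" for F F'
      using that by (intro bexI[of _ "F \<union> F'"]) (auto simp: restrict_def fun_eq_iff)
    show "\<exists>F\<in>?I. restrict x F \<noteq> restrict y F"
      if "x \<in> topspace ?Z" "y \<in> topspace ?Z" "x \<noteq> y" for x y
    proof -
      have "x \<in> extensional (carrier G)" "y \<in> extensional (carrier G)"
        using that ext assms(1) by auto
      then obtain g where "g \<in> carrier G" "x g \<noteq> y g"
        using \<open>x \<noteq> y\<close> extensionalityI by blast
      then show ?thesis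
        by (intro bexI[of _ "{g}"]) (auto simp: restrict_def fun_eq_iff)
    qed
  qed
  then obtain F where "finite F" "F \<subseteq> carrier G"
    "\<And>x y. x \<in> Y \<Longrightarrow> y \<in> Y \<Longrightarrow> restrict x F = restrict y F \<Longrightarrow> p x = p y"
    using assms(1) by auto
  then show ?thesis by (metis restrict_ext)
qed

text \<open>The continuity part of the Curtis-Hedlund-Lyndon theorem: finitely many output letters
  together form one locally constant map of the input.\<close>

lemma subshift_map_windows:
  assumes Y: "subshift G \<Sigma> Y" and Y': "subshift G \<Sigma>' Y'"
    and f: "continuous_map (subshift_space G \<Sigma> Y) (subshift_space G \<Sigma>' Y') f"
    and F: "finite F" "F \<subseteq> carrier G"
  shows "\<exists>F'. finite F' \<and> F' \<subseteq> carrier G \<and>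
           (\<forall>x\<in>Y. \<forall>y\<in>Y. (\<forall>g\<in>F'. x g = y g) \<longrightarrow> (\<forall>g\<in>F. f x g = f y g))"
proof -
  have "continuous_map (subshift_space G \<Sigma> Y) (discrete_topology UNIV) (\<lambda>y. f y g)"
    if "g \<in> F" for g
    using continuous_map_compose[OF f continuous_map_subshift_coordinate[OF Y', of g]] that F
    by (auto simp: o_def)
  then have "continuous_map (subshift_space G \<Sigma> Y) (discrete_topology UNIV)
      (\<lambda>y. restrict (f y) F)"
    by (intro continuous_map_discrete_restrict F(1))
  from subshift_windows[OF Y this] obtain F' where F': "finite F'" "F' \<subseteq> carrier G"
    and *: "\<And>x y. x \<in> Y \<Longrightarrow> y \<in> Y \<Longrightarrow> \<forall>g\<in>F'. x g = y g \<Longrightarrow> restrict (f x) F = restrict (f y) F"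
    by blast
  have "f x g = f y g" if "x \<in> Y" "y \<in> Y" "\<forall>g\<in>F'. x g = y g" "g \<in> F" for x y g
    using fun_cong[OF *[OF that(1-3)], of g] that(4) by simp
  then show ?thesis using F' by (intro exI[of _ F'] conjI ballI impI)
qed


section \<open>Inverse limits of compact spaces\<close>

lemma topspace_inverse_limit_space:
  "topspace (inverse_limit_space \<Lambda> leq X \<phi>) =
     {x \<in> (\<Pi>\<^sub>E i\<in>\<Lambda>. topspace (X i)). \<forall>i\<in>\<Lambda>. \<forall>j\<in>\<Lambda>. leq i j \<longrightarrow> x i = \<phi> i j (x j)}"
  unfolding inverse_limit_space_def by auto

lemma inverse_systemD:
  assumes "inverse_system G \<Lambda> leq X \<Phi> \<phi>"
  shows "\<And>i. i \<in> \<Lambda> \<Longrightarrow> leq i i"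
    and "\<And>i j k. \<lbrakk>i \<in> \<Lambda>; j \<in> \<Lambda>; k \<in> \<Lambda>; leq i j; leq j k\<rbrakk> \<Longrightarrow> leq i k"
    and "\<And>i j. \<lbrakk>i \<in> \<Lambda>; j \<in> \<Lambda>\<rbrakk> \<Longrightarrow> \<exists>k\<in>\<Lambda>. leq i k \<and> leq j k"
    and "\<And>i. i \<in> \<Lambda> \<Longrightarrow> dynamical_system G (X i) (\<Phi> i)"
    and "\<And>i j. \<lbrakk>i \<in> \<Lambda>; j \<in> \<Lambda>; leq i j\<rbrakk> \<Longrightarrow> continuous_map (X j) (X i) (\<phi> i j)"
    and "\<And>i j k x. \<lbrakk>i \<in> \<Lambda>; j \<in> \<Lambda>; k \<in> \<Lambda>; leq i j; leq j k; x \<in> topspace (X k)\<rbrakk>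
           \<Longrightarrow> \<phi> i k x = \<phi> i j (\<phi> j k x)"
    and "\<And>i j g x. \<lbrakk>i \<in> \<Lambda>; j \<in> \<Lambda>; leq i j; g \<in> carrier G; x \<in> topspace (X j)\<rbrakk>
           \<Longrightarrow> \<Phi> i g (\<phi> i j x) = \<phi> i j (\<Phi> j g x)"
    and "\<Lambda> \<noteq> {}"
proof -
  note * = assms[unfolded inverse_system_def directed_index_set_def]
  note a = conjunct1[OF *] and b = conjunct2[OF *]
  note a2 = conjunct2[OF a]
  show "\<Lambda> \<noteq> {}" using a by (rule conjunct1)
  show "\<And>i. i \<in> \<Lambda> \<Longrightarrow> leq i i" using conjunct1[OF a2] by blast
  show "\<And>i j k. \<lbrakk>i \<in> \<Lambda>; j \<in> \<Lambda>; k \<in> \<Lambda>; leq i j; leq j k\<rbrakk> \<Longrightarrow> leq i k"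
    using conjunct1[OF conjunct2[OF a2]] by blast
  show "\<And>i j. \<lbrakk>i \<in> \<Lambda>; j \<in> \<Lambda>\<rbrakk> \<Longrightarrow> \<exists>k\<in>\<Lambda>. leq i k \<and> leq j k"
    using conjunct2[OF conjunct2[OF a2]] by blast
  note b2 = conjunct2[OF b] note b4 = conjunct2[OF conjunct2[OF b2]]
  show "\<And>i. i \<in> \<Lambda> \<Longrightarrow> dynamical_system G (X i) (\<Phi> i)" using conjunct1[OF b] by blast
  show "\<And>i j. \<lbrakk>i \<in> \<Lambda>; j \<in> \<Lambda>; leq i j\<rbrakk> \<Longrightarrow> continuous_map (X j) (X i) (\<phi> i j)"
    using conjunct1[OF b2] by blast
  show "\<And>i j k x. \<lbrakk>i \<in> \<Lambda>; j \<in> \<Lambda>; k \<in> \<Lambda>; leq i j; leq j k; x \<in> topspace (X k)\<rbrakk>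
      \<Longrightarrow> \<phi> i k x = \<phi> i j (\<phi> j k x)"
    using conjunct1[OF b4] by blast
  show "\<And>i j g x. \<lbrakk>i \<in> \<Lambda>; j \<in> \<Lambda>; leq i j; g \<in> carrier G; x \<in> topspace (X j)\<rbrakk>
      \<Longrightarrow> \<Phi> i g (\<phi> i j x) = \<phi> i j (\<Phi> j g x)"
    using conjunct2[OF b4] by blast
qed

text \<open>Coherence is imposed only below one index \<open>k\<close> at a time. A preimage of
  \<open>p\<close> at \<open>k\<close> satisfies it, and compactness of the product yields a point
  that is coherent everywhere.\<close>

lemma inverse_limit_space_lift:
  assumes sys: "inverse_system G \<Lambda> leq X \<Phi> \<phi>" and l: "l \<in> \<Lambda>"
    and p: "\<And>k. k \<in> \<Lambda> \<Longrightarrow> leq l k \<Longrightarrow> p \<in> \<phi> l k ` topspace (X k)"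
  shows "\<exists>x\<in>topspace (inverse_limit_space \<Lambda> leq X \<phi>). x l = p"
proof -
  let ?P = "product_topology X \<Lambda>"
  let ?I = "{k \<in> \<Lambda>. leq l k}"
  note refl = inverse_systemD(1)[OF sys] and trans = inverse_systemD(2)[OF sys]
    and dir = inverse_systemD(3)[OF sys] and cont = inverse_systemD(5)[OF sys]
    and comp = inverse_systemD(6)[OF sys]
  have cpt: "\<And>i. i \<in> \<Lambda> \<Longrightarrow> compact_space (X i)"
    and haus: "\<And>i. i \<in> \<Lambda> \<Longrightarrow> Hausdorff_space (X i)"
    using inverse_systemD(4)[OF sys] unfolding dynamical_system_def by auto
  have pX: "p \<in> topspace (X l)"
    using p[OF l refl[OF l]] cont[OF l l refl[OF l]] by (auto simp: continuous_map_def)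
  \<comment> \<open>\<open>C k\<close> prescribes \<open>p\<close> at \<open>l\<close> and makes
    every coordinate below \<open>k\<close> the image of coordinate \<open>k\<close>. Coordinates
    not below \<open>k\<close> stay free, and \<open>C k\<close> shrinks as \<open>k\<close>
    grows.\<close>
  define C where "C k = {x \<in> topspace ?P. x l = p} \<inter>
      (\<Inter>i\<in>{i\<in>\<Lambda>. leq i k}. {x \<in> topspace ?P. x i = \<phi> i k (x k)})" for k
  have "\<exists>x\<in>topspace ?P. \<forall>k\<in>?I. x \<in> C k"
  proof (rule directed_closed_Inter_nonempty)
    show "compact_space ?P" using cpt by (simp add: compact_space_product_topology)
    show "?I \<noteq> {}" using l refl by auto
    show "closedin ?P (C k)" if k: "k \<in> ?I" for k
    proof -
      have "closedin ?P {x \<in> topspace ?P. x l = p}"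
        using closedin_continuous_map_preimage[OF continuous_map_product_projection[OF l, of X],
            of "{p}"] closedin_Hausdorff_singleton[OF haus[OF l] pX] by simp
      moreover have "closedin ?P {x \<in> topspace ?P. x i = \<phi> i k (x k)}"
        if i: "i \<in> {i \<in> \<Lambda>. leq i k}" for i
      proof (rule closedin_continuous_maps_eq[of "X i"])
        show "continuous_map ?P (X i) (\<lambda>x. \<phi> i k (x k))"
          using continuous_map_compose[OF continuous_map_product_projection[of k \<Lambda> X] cont[of i k]] i k
          by (simp add: o_def)
      qed (use i haus continuous_map_product_projection in auto)
      moreover have "{i \<in> \<Lambda>. leq i k} \<noteq> {}" using k l by auto
      ultimately show ?thesis unfolding C_def by (intro closedin_Int closedin_INT) auto
    qed
    show "C k \<noteq> {}" if k: "k \<in> ?I" for k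
    proof -
      \<comment> \<open>Every space of the system receives a map from one that contains a preimage
        of \<open>p\<close>. The points \<open>b i\<close> obtained from this fill the coordinates
        not below \<open>k\<close>.\<close>
      have "topspace (X i) \<noteq> {}" if i: "i \<in> \<Lambda>" for i
      proof -
        obtain j where j: "j \<in> \<Lambda>" "leq l j" "leq i j" using dir l i by blast
        then show ?thesis using p[of j] cont[of i j] i by (fastforce simp: continuous_map_def)
      qed
      then have "\<forall>i\<in>\<Lambda>. \<exists>y. y \<in> topspace (X i)" by blast
      then obtain b where b: "\<And>i. i \<in> \<Lambda> \<Longrightarrow> b i \<in> topspace (X i)" using bchoice by metis
      obtain y where y: "y \<in> topspace (X k)" "p = \<phi> l k y" using p k by auto
      let ?x = "\<lambda>i\<in>\<Lambda>. if leq i k then \<phi> i k y else b i"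
      have "?x \<in> topspace ?P"
        using b y cont k by (fastforce simp: continuous_map_def)
      moreover have "\<phi> k k y \<in> topspace (X k)"
        using cont[of k k] k refl y by (auto simp: continuous_map_def)
      moreover have "\<phi> i k y = \<phi> i k (\<phi> k k y)" if "i \<in> \<Lambda>" "leq i k" for i
        using comp[of i k k y] that k refl y by auto
      moreover have "?x k = \<phi> k k y" "?x l = p" using k refl l y(2) by auto
      ultimately have "?x \<in> C k" unfolding C_def by simp
      then show ?thesis by blast
    qed
    show "\<exists>k\<in>?I. C k \<subseteq> C i \<inter> C j" if i: "i \<in> ?I" and j: "j \<in> ?I" for i j
    proof -
      obtain k where k: "k \<in> \<Lambda>" "leq i k" "leq j k" using dir i j by blast
      \<comment> \<open>Indices below \<open>m\<close> are also below \<open>k\<close>, so coherence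
        with \<open>k\<close> passes to \<open>m\<close> by the composition law.\<close>
      have sub: "C k \<subseteq> C m" if m: "m \<in> \<Lambda>" "leq m k" for m
      proof
        fix x assume x: "x \<in> C k"
        then have xk: "x k \<in> topspace (X k)" and xP: "x \<in> topspace ?P" "x l = p"
          using k l unfolding C_def by auto
        have eq: "x n = \<phi> n k (x k)" if "n \<in> \<Lambda>" "leq n k" for n
          using x that unfolding C_def by auto
        have "x n = \<phi> n m (x m)" if n: "n \<in> \<Lambda>" "leq n m" for n
          using eq[of n] eq[of m] comp[of n m k "x k"] n m k xk trans by metis
        then show "x \<in> C m" using xP unfolding C_def by auto
      qed
      have "leq l k" using trans[OF l _ k(1) _ k(2)] i by auto
      then show ?thesis using sub[of i] sub[of j] i j k by auto
    qed
  qed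
  then obtain x where x: "x \<in> topspace ?P" "\<And>k. k \<in> ?I \<Longrightarrow> x \<in> C k" by blast
  have "x i = \<phi> i j (x j)" if ij: "i \<in> \<Lambda>" "j \<in> \<Lambda>" "leq i j" for i j
  proof -
    \<comment> \<open>An upper bound \<open>k\<close> of \<open>l\<close> and \<open>j\<close> also
      bounds \<open>i\<close>; membership in \<open>C k\<close> expresses both coordinates through
      coordinate \<open>k\<close>.\<close>
    obtain k where k: "k \<in> \<Lambda>" "leq l k" "leq j k" using dir l ij by blast
    have "leq i k" using trans ij k by blast
    then have "x i = \<phi> i k (x k)" "x j = \<phi> j k (x k)" "x k \<in> topspace (X k)"
      using x(2)[of k] x(1) k ij unfolding C_def by auto
    then show ?thesis using comp[of i j k "x k"] ij k by simp
  qed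
  moreover have "x l = p" using x(2)[of l] l refl unfolding C_def by auto
  ultimately show ?thesis
    unfolding topspace_inverse_limit_space using x(1) by auto
qed

text \<open>The index \<open>j\<close> is a stability index for \<open>i\<close>. An index
  \<open>k\<close> above \<open>i\<close> need not lie above \<open>j\<close>; a common upper bound
  \<open>m\<close> shows that the image of the space at \<open>k\<close> still contains the stable
  image, so stable points lift.\<close>

lemma mittag_leffler_limit_image:
  assumes sys: "inverse_system G \<Lambda> leq X \<Phi> \<phi>" and ml: "mittag_leffler \<Lambda> leq X \<phi>"
    and i: "i \<in> \<Lambda>"
  obtains j where "j \<in> \<Lambda>" "leq i j"
    "\<And>y. y \<in> topspace (X j) \<Longrightarrow> \<exists>x\<in>topspace (inverse_limit_space \<Lambda> leq X \<phi>). x i = \<phi> i j y"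
proof -
  obtain j where j: "j \<in> \<Lambda>" "leq i j"
    and st: "\<And>k. k \<in> \<Lambda> \<Longrightarrow> leq j k \<Longrightarrow> \<phi> i k ` topspace (X k) = \<phi> i j ` topspace (X j)"
    using ml i unfolding mittag_leffler_def by meson
  have "\<exists>x\<in>topspace (inverse_limit_space \<Lambda> leq X \<phi>). x i = \<phi> i j y"
    if y: "y \<in> topspace (X j)" for y
  proof (rule inverse_limit_space_lift[OF sys i])
    fix k assume k: "k \<in> \<Lambda>" "leq i k"
    obtain m where m: "m \<in> \<Lambda>" "leq j m" "leq k m"
      using inverse_systemD(3)[OF sys j(1) k(1)] by blast
    have "\<phi> i j y \<in> \<phi> i m ` topspace (X m)" using st[OF m(1,2)] y by blast
    then obtain z where z: "z \<in> topspace (X m)" "\<phi> i j y = \<phi> i m z" by blast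
    have "\<phi> i m z = \<phi> i k (\<phi> k m z)"
      using inverse_systemD(6)[OF sys i k(1) m(1) k(2) m(3) z(1)] .
    moreover have "\<phi> k m z \<in> topspace (X k)"
      using inverse_systemD(5)[OF sys k(1) m(1) m(3)] z(1) by (auto simp: continuous_map_def)
    ultimately show "\<phi> i j y \<in> \<phi> i k ` topspace (X k)" using z(2) by simp
  qed
  with j that show ?thesis by blast
qed


section \<open>Pseudo-orbits in shifts of finite type\<close>

text \<open>The assumption on \<open>y\<close> says that \<open>y (s g)\<close> agrees on
  \<open>B\<close> with the shift of \<open>y g\<close> by \<open>s\<close>. Along a word for
  \<open>a\<close> these agreements chain together, the observed coordinate moving with each letter.
  The finite set \<open>B\<close> is chosen before \<open>y\<close> and depends on \<open>a\<close>
  and \<open>c\<close> alone.\<close>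

lemma generated_one_step_propagation:
  fixes G :: "('g, 'm) monoid_scheme"
  assumes "group G" and S: "S \<subseteq> carrier G" and "a \<in> generate G S" and "c \<in> carrier G"
  shows "\<exists>B. finite B \<and> B \<subseteq> carrier G \<and> (\<forall>y :: 'g \<Rightarrow> 'g \<Rightarrow> 'a.
           (\<forall>g\<in>carrier G. \<forall>s\<in>S. \<forall>b\<in>B. y (s \<otimes>\<^bsub>G\<^esub> g) b = y g (b \<otimes>\<^bsub>G\<^esub> s)) \<longrightarrow>
           (\<forall>g\<in>carrier G. y (a \<otimes>\<^bsub>G\<^esub> g) c = y g (c \<otimes>\<^bsub>G\<^esub> a)))"
  using assms(3,4)
proof (induction arbitrary: c rule: generate.induct)
  interpret group G by fact
  {
    case one
    then show ?case by (intro exI[of _ "{}"]) simp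
  next
    case (incl h)
    then show ?case by (intro exI[of _ "{c}"]) auto
  next
    case (inv h)
    then have h: "h \<in> carrier G" using S by blast
    have "y (inv\<^bsub>G\<^esub> h \<otimes>\<^bsub>G\<^esub> g) c = y g (c \<otimes>\<^bsub>G\<^esub> inv\<^bsub>G\<^esub> h)"
      if y: "\<forall>g\<in>carrier G. \<forall>s\<in>S. \<forall>b\<in>{c \<otimes>\<^bsub>G\<^esub> inv\<^bsub>G\<^esub> h}. y (s \<otimes>\<^bsub>G\<^esub> g) b = y g (b \<otimes>\<^bsub>G\<^esub> s)"
        and g: "g \<in> carrier G" for y :: "'g \<Rightarrow> 'g \<Rightarrow> 'a" and g
    proof -
      \<comment> \<open>An inverse generator is a generator step read backwards: the step
        \<open>h\<close> leads from \<open>inv h g\<close> to \<open>g\<close>, and it moves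
        coordinate \<open>c inv h\<close> to \<open>c\<close>.\<close>
      have "y (h \<otimes>\<^bsub>G\<^esub> (inv\<^bsub>G\<^esub> h \<otimes>\<^bsub>G\<^esub> g)) (c \<otimes>\<^bsub>G\<^esub> inv\<^bsub>G\<^esub> h)
          = y (inv\<^bsub>G\<^esub> h \<otimes>\<^bsub>G\<^esub> g) (c \<otimes>\<^bsub>G\<^esub> inv\<^bsub>G\<^esub> h \<otimes>\<^bsub>G\<^esub> h)"
        using y g h inv by simp
      then show ?thesis
        using g h inv.prems by (simp add: m_assoc) (simp flip: m_assoc)
    qed
    then show ?case using h inv.prems by (intro exI[of _ "{c \<otimes>\<^bsub>G\<^esub> inv\<^bsub>G\<^esub> h}"]) auto
  next
    case (eng h1 h2)
    have h: "h1 \<in> carrier G" "h2 \<in> carrier G"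
      using generate_in_carrier[OF S] eng.hyps by auto
    obtain B1 where B1: "finite B1 \<and> B1 \<subseteq> carrier G \<and> (\<forall>y :: 'g \<Rightarrow> 'g \<Rightarrow> 'a.
        (\<forall>g\<in>carrier G. \<forall>s\<in>S. \<forall>b\<in>B1. y (s \<otimes>\<^bsub>G\<^esub> g) b = y g (b \<otimes>\<^bsub>G\<^esub> s)) \<longrightarrow>
        (\<forall>g\<in>carrier G. y (h1 \<otimes>\<^bsub>G\<^esub> g) c = y g (c \<otimes>\<^bsub>G\<^esub> h1)))"
      using eng.IH(1)[OF eng.prems] by (rule exE)
    \<comment> \<open>The first factor has moved the observed coordinate from \<open>c\<close> to
      \<open>c h1\<close>, so the second induction hypothesis is taken there.\<close>
    obtain B2 where B2: "finite B2 \<and> B2 \<subseteq> carrier G \<and> (\<forall>y :: 'g \<Rightarrow> 'g \<Rightarrow> 'a.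
        (\<forall>g\<in>carrier G. \<forall>s\<in>S. \<forall>b\<in>B2. y (s \<otimes>\<^bsub>G\<^esub> g) b = y g (b \<otimes>\<^bsub>G\<^esub> s)) \<longrightarrow>
        (\<forall>g\<in>carrier G. y (h2 \<otimes>\<^bsub>G\<^esub> g) (c \<otimes>\<^bsub>G\<^esub> h1) = y g (c \<otimes>\<^bsub>G\<^esub> h1 \<otimes>\<^bsub>G\<^esub> h2)))"
      using eng.IH(2)[OF m_closed[OF eng.prems h(1)]] by (rule exE)
    show ?case
    proof (intro exI[of _ "B1 \<union> B2"] conjI allI impI ballI)
      fix y :: "'g \<Rightarrow> 'g \<Rightarrow> 'a" and g
      assume y: "\<forall>g\<in>carrier G. \<forall>s\<in>S. \<forall>b\<in>B1 \<union> B2. y (s \<otimes>\<^bsub>G\<^esub> g) b = y g (b \<otimes>\<^bsub>G\<^esub> s)"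
        and g: "g \<in> carrier G"
      have "\<forall>g\<in>carrier G. \<forall>s\<in>S. \<forall>b\<in>B1. y (s \<otimes>\<^bsub>G\<^esub> g) b = y g (b \<otimes>\<^bsub>G\<^esub> s)"
        using y by simp
      from bspec[OF mp[OF spec[OF conjunct2[OF conjunct2[OF B1]]] this], of "h2 \<otimes>\<^bsub>G\<^esub> g"]
      have "y (h1 \<otimes>\<^bsub>G\<^esub> (h2 \<otimes>\<^bsub>G\<^esub> g)) c = y (h2 \<otimes>\<^bsub>G\<^esub> g) (c \<otimes>\<^bsub>G\<^esub> h1)"
        using g h by simp
      moreover have "\<forall>g\<in>carrier G. \<forall>s\<in>S. \<forall>b\<in>B2. y (s \<otimes>\<^bsub>G\<^esub> g) b = y g (b \<otimes>\<^bsub>G\<^esub> s)"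
        using y by simp
      from bspec[OF mp[OF spec[OF conjunct2[OF conjunct2[OF B2]]] this] g]
      have "y (h2 \<otimes>\<^bsub>G\<^esub> g) (c \<otimes>\<^bsub>G\<^esub> h1) = y g (c \<otimes>\<^bsub>G\<^esub> h1 \<otimes>\<^bsub>G\<^esub> h2)" .
      ultimately show "y (h1 \<otimes>\<^bsub>G\<^esub> h2 \<otimes>\<^bsub>G\<^esub> g) c = y g (c \<otimes>\<^bsub>G\<^esub> (h1 \<otimes>\<^bsub>G\<^esub> h2))"
        using g h eng.prems by (simp add: m_assoc)
    qed (use B1 B2 in auto)
  }
qed

text \<open>
  The glued configuration is \<open>g \<mapsto> y g \<one>\<close>. Around \<open>g\<close> it looks like \<open>y g\<close> on the window of the
  forbidden patterns, so none of them occurs in it.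
\<close>

lemma SFT_glue_pseudo_orbit:
  fixes G :: "('g, 'm) monoid_scheme" and \<Sigma> :: "'a set"
  assumes "group G" and "finite_generator G S" and sft: "shift_of_finite_type G \<Sigma> Y"
    and F: "finite F" "F \<subseteq> carrier G"
  shows "\<exists>B. finite B \<and> B \<subseteq> carrier G \<and> (\<forall>y.
           (\<forall>g\<in>carrier G. y g \<in> Y) \<and>
           (\<forall>g\<in>carrier G. \<forall>s\<in>S. \<forall>b\<in>B. y (s \<otimes>\<^bsub>G\<^esub> g) b = y g (b \<otimes>\<^bsub>G\<^esub> s)) \<longrightarrow>
           (\<exists>w\<in>Y. \<forall>g\<in>carrier G. \<forall>a\<in>F. shift_act G g w a = y g a))"
proof -
  interpret group G by fact
  obtain A \<F> where A: "finite A" "A \<subseteq> carrier G"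
    and Y: "Y = {x \<in> carrier G \<rightarrow>\<^sub>E \<Sigma>. \<forall>g\<in>carrier G. \<forall>P\<in>\<F>. shift_act G g x \<notin> cylinder G \<Sigma> A P}"
    using sft unfolding shift_of_finite_type_def by blast
  have sub: "subshift G \<Sigma> Y" using sft unfolding shift_of_finite_type_def by blast
  have S: "S \<subseteq> carrier G" "generate G S = carrier G"
    using assms(2) unfolding finite_generator_def by auto
  let ?step = "\<lambda>B (y :: 'g \<Rightarrow> 'g \<Rightarrow> 'a). \<forall>g\<in>carrier G. \<forall>s\<in>S. \<forall>b\<in>B. y (s \<otimes>\<^bsub>G\<^esub> g) b = y g (b \<otimes>\<^bsub>G\<^esub> s)"
  \<comment> \<open>Propagation at coordinate \<open>\<one>\<close> identifies the diagonal value at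
    \<open>a g\<close> with \<open>y g a\<close>. The set \<open>A\<close> guards against forbidden
    patterns, and \<open>F\<close> is the window on which agreement is wanted.\<close>
  have "\<forall>a\<in>A \<union> F. \<exists>B. finite B \<and> B \<subseteq> carrier G \<and> (\<forall>y. ?step B y \<longrightarrow>
      (\<forall>g\<in>carrier G. y (a \<otimes>\<^bsub>G\<^esub> g) \<one>\<^bsub>G\<^esub> = y g (\<one>\<^bsub>G\<^esub> \<otimes>\<^bsub>G\<^esub> a)))"
  proof
    fix a assume "a \<in> A \<union> F"
    then have "a \<in> generate G S" using A F S(2) by blast
    from generated_one_step_propagation[OF assms(1) S(1) this one_closed]
    show "\<exists>B. finite B \<and> B \<subseteq> carrier G \<and> (\<forall>y. ?step B y \<longrightarrow>
      (\<forall>g\<in>carrier G. y (a \<otimes>\<^bsub>G\<^esub> g) \<one>\<^bsub>G\<^esub> = y g (\<one>\<^bsub>G\<^esub> \<otimes>\<^bsub>G\<^esub> a)))" .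
  qed
  from bchoice[OF this] obtain b where
    b: "\<forall>a\<in>A \<union> F. finite (b a) \<and> b a \<subseteq> carrier G \<and> (\<forall>y. ?step (b a) y \<longrightarrow>
      (\<forall>g\<in>carrier G. y (a \<otimes>\<^bsub>G\<^esub> g) \<one>\<^bsub>G\<^esub> = y g (\<one>\<^bsub>G\<^esub> \<otimes>\<^bsub>G\<^esub> a)))"
    by (rule exE)
  show ?thesis
  proof (intro exI[of _ "\<Union>(b ` (A \<union> F))"] conjI allI impI)
    show "finite (\<Union>(b ` (A \<union> F)))" using A F b by simp
    show "\<Union>(b ` (A \<union> F)) \<subseteq> carrier G" using b by (simp add: UN_subset_iff)
    fix y assume y: "(\<forall>g\<in>carrier G. y g \<in> Y) \<and> ?step (\<Union>(b ` (A \<union> F))) y"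
    then have yY: "\<And>g. g \<in> carrier G \<Longrightarrow> y g \<in> Y" by blast
    define w where "w = (\<lambda>g\<in>carrier G. y g \<one>\<^bsub>G\<^esub>)"
    have w: "shift_act G g w a = y g a" if g: "g \<in> carrier G" and a: "a \<in> A \<union> F" for g a
    proof -
      have aG: "a \<in> carrier G" using a A F by blast
      have "?step (b a) y" by (intro ballI bspec[OF bspec[OF bspec[OF conjunct2[OF y]]]] UN_I[OF a])
      from bspec[OF mp[OF spec[OF conjunct2[OF conjunct2[OF bspec[OF b a]]]] this] g]
      have "y (a \<otimes>\<^bsub>G\<^esub> g) \<one>\<^bsub>G\<^esub> = y g (\<one>\<^bsub>G\<^esub> \<otimes>\<^bsub>G\<^esub> a)" .
      then show ?thesis using aG g by (simp add: shift_act_def w_def)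
    qed
    have y_fun: "y g \<in> carrier G \<rightarrow>\<^sub>E \<Sigma>" if "g \<in> carrier G" for g
      using yY[OF that] Y by blast
    then have w_fun: "w \<in> carrier G \<rightarrow>\<^sub>E \<Sigma>"
      unfolding w_def by (auto simp: PiE_iff)
    have "shift_act G g w \<notin> cylinder G \<Sigma> A P" if g: "g \<in> carrier G" and P: "P \<in> \<F>" for g P
    proof
      \<comment> \<open>A forbidden pattern of \<open>w\<close> at \<open>g\<close> would also occur
        in \<open>y g\<close> at the identity, against \<open>y g \<in> Y\<close>.\<close>
      assume "shift_act G g w \<in> cylinder G \<Sigma> A P"
      then have "\<forall>a\<in>A. y g a = P a" using w[OF g] unfolding cylinder_def by auto
      then have "y g \<in> cylinder G \<Sigma> A P" using y_fun[OF g] unfolding cylinder_def by blast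
      moreover have "shift_act G \<one>\<^bsub>G\<^esub> (y g) = y g"
        using shift_act_one[OF assms(1)] y_fun[OF g] by (auto simp: PiE_def)
      moreover have "shift_act G \<one>\<^bsub>G\<^esub> (y g) \<notin> cylinder G \<Sigma> A P"
        using yY[OF g] P unfolding Y by blast
      ultimately show False by simp
    qed
    then have "w \<in> Y" unfolding Y using w_fun by blast
    then show "\<exists>w\<in>Y. \<forall>g\<in>carrier G. \<forall>a\<in>F. shift_act G g w a = y g a"
      using w by blast
  qed
qed

section \<open>Shadowing from a Mittag-Leffler limit\<close>

proposition shadowing_if_limit_of_SFTs:
  fixes G :: "('g, 'm) monoid_scheme"
  assumes "group G" and gen: "finite_generator G S" and dyn: "dynamical_system G X \<Phi>"
    and lim: "conjugate_to_ML_limit_of_SFTs TYPE('l) TYPE('a) G X \<Phi>"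
  shows "shadowing_property G X \<Phi> S"
  unfolding shadowing_property_def
proof (intro allI impI)
  interpret group G by fact
  fix \<U> assume \<U>: "finite_open_cover X \<U>"
  obtain \<Lambda> :: "'l set" and leq and \<Sigma> :: "'l \<Rightarrow> 'a set" and Y \<phi> where
    sys: "SFT_ML_inverse_system G \<Lambda> leq \<Sigma> Y \<phi>" and
    con: "conjugate_systems G X \<Phi>
          (inverse_limit_space \<Lambda> leq (\<lambda>i. subshift_space G (\<Sigma> i) (Y i)) \<phi>)
          (inverse_limit_act \<Lambda> (\<lambda>_. shift_act G))"
    using lim unfolding conjugate_to_ML_limit_of_SFTs_def by blast
  let ?Z = "\<lambda>i. subshift_space G (\<Sigma> i) (Y i)"
  let ?L = "inverse_limit_space \<Lambda> leq ?Z \<phi>"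
  have sft: "\<And>i. i \<in> \<Lambda> \<Longrightarrow> shift_of_finite_type G (\<Sigma> i) (Y i)"
    and inv: "inverse_system G \<Lambda> leq ?Z (\<lambda>_. shift_act G) \<phi>"
    and ml: "mittag_leffler \<Lambda> leq ?Z \<phi>"
    using sys unfolding SFT_ML_inverse_system_def by auto
  have sub: "subshift G (\<Sigma> i) (Y i)" if "i \<in> \<Lambda>" for i
    using sft[OF that] unfolding shift_of_finite_type_def by blast
  have top: "topspace (?Z i) = Y i" if "i \<in> \<Lambda>" for i using sub[OF that] by simp
  obtain h where hom: "homeomorphic_map X ?L h"
    and act: "\<And>g x. g \<in> carrier G \<Longrightarrow> x \<in> topspace X \<Longrightarrow>
        h (\<Phi> g x) = inverse_limit_act \<Lambda> (\<lambda>_. shift_act G) g (h x)"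
    using con unfolding conjugate_systems_def by blast
  have h_img: "h ` topspace X = topspace ?L" and h_inj: "inj_on h (topspace X)"
    and h_cont: "continuous_map X ?L h"
    using hom by (auto simp: homeomorphic_eq_everything_map)
  have hL: "h x \<in> topspace ?L" if "x \<in> topspace X" for x using that h_img by blast
  have hY: "h x i \<in> Y i" if "x \<in> topspace X" "i \<in> \<Lambda>" for x i
    using hL[OF that(1)] that(2) top unfolding topspace_inverse_limit_space by auto
  have hext: "h x \<in> extensional \<Lambda>" if "x \<in> topspace X" for x
    using hL[OF that] unfolding topspace_inverse_limit_space by (auto simp: PiE_def)
  have hYext: "h x i \<in> extensional (carrier G)" if "x \<in> topspace X" "i \<in> \<Lambda>" for x i
    using hY[OF that] subshift_subset[OF sub[OF that(2)]] by (auto simp: PiE_def)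
  have h\<phi>: "h x i = \<phi> i j (h x j)" if "x \<in> topspace X" "i \<in> \<Lambda>" "j \<in> \<Lambda>" "leq i j" for x i j
    using hL[OF that(1)] that(2-4) unfolding topspace_inverse_limit_space by blast
  have hact: "h (\<Phi> g x) i = shift_act G g (h x i)"
    if "g \<in> carrier G" "x \<in> topspace X" "i \<in> \<Lambda>" for g x i
    using act[OF that(1,2)] that(3) by (simp add: inverse_limit_act_def)
  have cptX: "compact_space X" using dyn unfolding dynamical_system_def by blast
  have \<Phi>X: "\<Phi> g x \<in> topspace X" if "g \<in> carrier G" "x \<in> topspace X" for g x
    using dyn that unfolding dynamical_system_def
    by (metis homeomorphic_imp_surjective_map imageI)
  have coord: "continuous_map X (discrete_topology UNIV) (\<lambda>x. h x i g)"
    if i: "i \<in> \<Lambda>" and g: "g \<in> carrier G" for i g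
  proof -
    have "continuous_map ?L (?Z i) (\<lambda>x. x i)"
      unfolding inverse_limit_space_def
      using i by (intro continuous_map_from_subtopology continuous_map_product_projection)
    from continuous_map_compose[OF continuous_map_compose[OF h_cont this]
        continuous_map_subshift_coordinate[OF sub[OF i] g]]
    show ?thesis by (simp add: o_def)
  qed
  \<comment> \<open>The code of a point is the window \<open>F\<close> of its configuration at index
    \<open>i\<close>. The pairs \<open>(i, F)\<close> are directed and separate points, so these
    codes measure closeness in \<open>X\<close>.\<close>
  define q where "q = (\<lambda>(i, F) x. restrict (h x i) F)"
  let ?I = "\<Lambda> \<times> {F. finite F \<and> F \<subseteq> carrier G}"
  have q_cont: "continuous_map X (discrete_topology UNIV) (q (i, F))"
    if "i \<in> \<Lambda>" "finite F" "F \<subseteq> carrier G" for i F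
    unfolding q_def split using that coord by (intro continuous_map_discrete_restrict) auto
  have q_eq: "h x i g = h y i g" if "q (i, F) x = q (i, F) y" "g \<in> F" for i F x y g
    using fun_cong[OF that(1), of g] that(2) unfolding q_def by simp
  have "\<exists>n\<in>?I. \<forall>x\<in>topspace X. \<exists>U\<in>\<U>. \<forall>y\<in>topspace X. q n y = q n x \<longrightarrow> y \<in> U"
  proof (rule level_sets_refine_cover[OF cptX])
    show "?I \<noteq> {}"
      using inverse_systemD(8)[OF inv] by blast
    show "continuous_map X (discrete_topology UNIV) (q n)" if "n \<in> ?I" for n
      using that q_cont by auto
    show "\<exists>k\<in>?I. \<forall>x\<in>topspace X. \<forall>y\<in>topspace X. q k x = q k y \<longrightarrow> q m x = q m y \<and> q n x = q n y"
      if mn: "m \<in> ?I" "n \<in> ?I" for m n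
    proof -
      obtain i F where m: "m = (i, F)" "i \<in> \<Lambda>" "finite F" "F \<subseteq> carrier G" using mn(1) by auto
      obtain j F' where n: "n = (j, F')" "j \<in> \<Lambda>" "finite F'" "F' \<subseteq> carrier G" using mn(2) by auto
      obtain k where k: "k \<in> \<Lambda>" "leq i k" "leq j k"
        using inverse_systemD(3)[OF inv m(2) n(2)] by blast
      \<comment> \<open>Bonding maps depend on finite windows, so windows at \<open>i\<close> and
        \<open>j\<close> are both determined by windows at a common upper bound \<open>k\<close>;
        the union of the two serves.\<close>
      obtain E where E: "finite E" "E \<subseteq> carrier G"
        and E': "\<forall>x\<in>Y k. \<forall>y\<in>Y k. (\<forall>g\<in>E. x g = y g) \<longrightarrow> (\<forall>g\<in>F. \<phi> i k x g = \<phi> i k y g)"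
        using subshift_map_windows[OF sub[OF k(1)] sub[OF m(2)]
            inverse_systemD(5)[OF inv m(2) k(1,2)] m(3,4)] by blast
      obtain D where D: "finite D" "D \<subseteq> carrier G"
        and D': "\<forall>x\<in>Y k. \<forall>y\<in>Y k. (\<forall>g\<in>D. x g = y g) \<longrightarrow> (\<forall>g\<in>F'. \<phi> j k x g = \<phi> j k y g)"
        using subshift_map_windows[OF sub[OF k(1)] sub[OF n(2)]
            inverse_systemD(5)[OF inv n(2) k(1,3)] n(3,4)] by blast
      have "q m x = q m y \<and> q n x = q n y"
        if xy: "x \<in> topspace X" "y \<in> topspace X" "q (k, E \<union> D) x = q (k, E \<union> D) y" for x y
      proof -
        have "\<forall>g\<in>F. \<phi> i k (h x k) g = \<phi> i k (h y k) g"
          using E' hY[OF xy(1) k(1)] hY[OF xy(2) k(1)] q_eq[OF xy(3)] by blast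
        moreover have "\<forall>g\<in>F'. \<phi> j k (h x k) g = \<phi> j k (h y k) g"
          using D' hY[OF xy(1) k(1)] hY[OF xy(2) k(1)] q_eq[OF xy(3)] by blast
        ultimately show ?thesis
          unfolding m(1) n(1) q_def split
          using h\<phi>[OF xy(1) m(2) k(1,2)] h\<phi>[OF xy(2) m(2) k(1,2)]
            h\<phi>[OF xy(1) n(2) k(1,3)] h\<phi>[OF xy(2) n(2) k(1,3)] by (metis restrict_ext)
      qed
      then show ?thesis using k(1) E D by (intro bexI[of _ "(k, E \<union> D)"]) blast+
    qed
    show "\<exists>n\<in>?I. q n x \<noteq> q n y"
      if xy: "x \<in> topspace X" "y \<in> topspace X" "x \<noteq> y" for x y
    proof -
      have "h x \<noteq> h y" using h_inj xy unfolding inj_on_def by blast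
      then obtain i where i: "i \<in> \<Lambda>" "h x i \<noteq> h y i"
        using extensionalityI[OF hext[OF xy(1)] hext[OF xy(2)]] by blast
      then obtain g where g: "g \<in> carrier G" "h x i g \<noteq> h y i g"
        using extensionalityI[OF hYext[OF xy(1) i(1)] hYext[OF xy(2) i(1)]] by blast
      then have "q (i, {g}) x \<noteq> q (i, {g}) y" using q_eq[of i "{g}" x y g] by blast
      then show ?thesis using i g by blast
    qed
    show "\<exists>U\<in>\<U>. x \<in> U \<and> openin X U" if "x \<in> topspace X" for x
      using \<U> that unfolding finite_open_cover_def by blast
  qed
  then obtain i F where i: "i \<in> \<Lambda>" and F: "finite F" "F \<subseteq> carrier G"
    and fine: "\<And>x. x \<in> topspace X \<Longrightarrow>
        \<exists>U\<in>\<U>. \<forall>y\<in>topspace X. q (i, F) y = q (i, F) x \<longrightarrow> y \<in> U" by blast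
  \<comment> \<open>The constants are chosen backwards from the cover: \<open>(i, F)\<close>
    resolves it, \<open>j\<close> is a stability index for \<open>i\<close>, the window
    \<open>F'\<close> at \<open>j\<close> determines \<open>F\<close> at \<open>i\<close>, and
    \<open>B\<close> is what gluing needs in order to reproduce \<open>F'\<close>.\<close>
  obtain j where j: "j \<in> \<Lambda>" "leq i j"
    and lift: "\<And>y. y \<in> Y j \<Longrightarrow> \<exists>x\<in>topspace ?L. x i = \<phi> i j y"
    using mittag_leffler_limit_image[OF inv ml i] top by metis
  obtain F' where F': "finite F'" "F' \<subseteq> carrier G"
    and win: "\<forall>x\<in>Y j. \<forall>y\<in>Y j. (\<forall>g\<in>F'. x g = y g) \<longrightarrow> (\<forall>g\<in>F. \<phi> i j x g = \<phi> i j y g)"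
    using subshift_map_windows[OF sub[OF j(1)] sub[OF i]
        inverse_systemD(5)[OF inv i j] F] by blast
  obtain B where glue: "finite B \<and> B \<subseteq> carrier G \<and> (\<forall>y.
           (\<forall>g\<in>carrier G. y g \<in> Y j) \<and>
           (\<forall>g\<in>carrier G. \<forall>s\<in>S. \<forall>b\<in>B. y (s \<otimes>\<^bsub>G\<^esub> g) b = y g (b \<otimes>\<^bsub>G\<^esub> s)) \<longrightarrow>
           (\<exists>w\<in>Y j. \<forall>g\<in>carrier G. \<forall>a\<in>F'. shift_act G g w a = y g a))"
    using SFT_glue_pseudo_orbit[OF assms(1) gen sft[OF j(1)] F'] by (rule exE)
  then have B: "finite B" "B \<subseteq> carrier G" by blast+
  have SG: "S \<subseteq> carrier G" using gen unfolding finite_generator_def by blast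
  let ?\<V> = "(\<lambda>x. {y \<in> topspace X. q (j, B) y = q (j, B) x}) ` topspace X"
  show "\<exists>\<V>. finite_open_cover X \<V> \<and>
      (\<forall>x. pseudo_orbit G X \<Phi> S \<V> x \<longrightarrow> (\<exists>z\<in>topspace X. shadows G \<Phi> \<U> z x))"
  proof (intro exI[of _ ?\<V>] conjI allI impI)
    show "finite_open_cover X ?\<V>"
      by (rule finite_open_cover_level_sets[OF cptX q_cont[OF j(1) B]])
    fix x assume po: "pseudo_orbit G X \<Phi> S ?\<V> x"
    then have xX: "\<And>g. g \<in> carrier G \<Longrightarrow> x g \<in> topspace X" unfolding pseudo_orbit_def by blast
    have same: "q (j, B) (x (s \<otimes>\<^bsub>G\<^esub> g)) = q (j, B) (\<Phi> s (x g))"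
      if "g \<in> carrier G" "s \<in> S" for g s
    proof -
      obtain U where U: "\<forall>g\<in>carrier G. U g \<in> ?\<V>" "\<forall>g\<in>carrier G. \<forall>s\<in>S.
          x (s \<otimes>\<^bsub>G\<^esub> g) \<in> U (s \<otimes>\<^bsub>G\<^esub> g) \<and> \<Phi> s (x g) \<in> U (s \<otimes>\<^bsub>G\<^esub> g)"
        using po unfolding pseudo_orbit_def by blast
      have "U (s \<otimes>\<^bsub>G\<^esub> g) \<in> ?\<V>" using U(1) that SG by blast
      moreover have "x (s \<otimes>\<^bsub>G\<^esub> g) \<in> U (s \<otimes>\<^bsub>G\<^esub> g)" "\<Phi> s (x g) \<in> U (s \<otimes>\<^bsub>G\<^esub> g)"
        using U(2) that by auto
      ultimately show ?thesis by force
    qed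
    have "\<exists>w\<in>Y j. \<forall>g\<in>carrier G. \<forall>a\<in>F'. shift_act G g w a = h (x g) j a"
    proof (rule mp[OF spec[OF conjunct2[OF conjunct2[OF glue]]]], intro conjI ballI)
      show "h (x g) j \<in> Y j" if "g \<in> carrier G" for g
        using hY[OF xX[OF that] j(1)] .
      show "h (x (s \<otimes>\<^bsub>G\<^esub> g)) j b = h (x g) j (b \<otimes>\<^bsub>G\<^esub> s)"
        if "g \<in> carrier G" "s \<in> S" "b \<in> B" for g s b
      proof -
        have "h (x (s \<otimes>\<^bsub>G\<^esub> g)) j b = h (\<Phi> s (x g)) j b"
          by (rule q_eq[OF same[OF that(1,2)] that(3)])
        also have "\<dots> = shift_act G s (h (x g) j) b"
          using hact[OF _ xX[OF that(1)] j(1), of s] that SG by auto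
        also have "\<dots> = h (x g) j (b \<otimes>\<^bsub>G\<^esub> s)"
          using that B(2) by (auto simp: shift_act_def)
        finally show ?thesis .
      qed
    qed
    then obtain w where w: "w \<in> Y j"
      "\<forall>g\<in>carrier G. \<forall>a\<in>F'. shift_act G g w a = h (x g) j a" by (rule bexE)
    \<comment> \<open>Stability lifts only the image of \<open>w\<close> at \<open>i\<close>; the
      configuration \<open>h z j\<close> may differ from \<open>w\<close>.\<close>
    obtain z where z: "z \<in> topspace X" "h z i = \<phi> i j w"
      using lift[OF w(1)] h_img by (metis imageE)
    \<comment> \<open>The shifted \<open>w\<close> agrees with \<open>h (x g) j\<close> on
      \<open>F'\<close>. Through the equivariant bonding map this becomes equality of the
      \<open>(i, F)\<close>-codes of \<open>\<Phi> g z\<close> and \<open>x g\<close>, so the cover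
      set belonging to \<open>x g\<close> contains both.\<close>
    have "\<exists>U\<in>\<U>. \<Phi> g z \<in> U \<and> x g \<in> U" if g: "g \<in> carrier G" for g
    proof -
      have "shift_act G g w \<in> Y j" using sub[OF j(1)] w(1) g unfolding subshift_def by blast
      then have eq: "\<forall>a\<in>F. \<phi> i j (shift_act G g w) a = \<phi> i j (h (x g) j) a"
        using win bspec[OF w(2) g] hY[OF xX[OF g] j(1)] by blast
      have "h (\<Phi> g z) i = shift_act G g (\<phi> i j w)" using hact[OF g z(1) i] z(2) by simp
      also have "\<dots> = \<phi> i j (shift_act G g w)"
        using inverse_systemD(7)[OF inv i j g] top[OF j(1)] w(1) by simp
      finally have "q (i, F) (\<Phi> g z) = q (i, F) (x g)"
        unfolding q_def split h\<phi>[OF xX[OF g] i j] using eq by (metis restrict_ext)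
      then show ?thesis using fine[OF xX[OF g]] \<Phi>X[OF g z(1)] xX[OF g] by blast
    qed
    then show "\<exists>z\<in>topspace X. shadows G \<Phi> \<U> z x"
      using z(1) unfolding shadows_def by blast
  qed
qed


section \<open>Itinerary shifts\<close>

definition itinerary ::
    "('g, 'm) monoid_scheme \<Rightarrow> ('g \<Rightarrow> 'x \<Rightarrow> 'x) \<Rightarrow> ('x \<Rightarrow> 'a) \<Rightarrow> 'x \<Rightarrow> 'g \<Rightarrow> 'a" where
  "itinerary G \<Phi> q x = (\<lambda>g\<in>carrier G. q (\<Phi> g x))"

text \<open>
  Different transitions may be realised by different points, so the elements are coded pseudo-orbits.
\<close>

definition itinerary_shift ::
    "('g, 'm) monoid_scheme \<Rightarrow> 'x topology \<Rightarrow> ('g \<Rightarrow> 'x \<Rightarrow> 'x) \<Rightarrow> 'g set \<Rightarrow> ('x \<Rightarrow> 'a)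
      \<Rightarrow> ('g \<Rightarrow> 'a) set" where
  "itinerary_shift G X \<Phi> S q =
     {u \<in> carrier G \<rightarrow>\<^sub>E q ` topspace X. \<forall>g\<in>carrier G. \<forall>s\<in>S.
        \<exists>x\<in>topspace X. q x = u g \<and> q (\<Phi> s x) = u (s \<otimes>\<^bsub>G\<^esub> g)}"

definition finer_map :: "'x topology \<Rightarrow> ('x \<Rightarrow> 'a) \<Rightarrow> ('x \<Rightarrow> 'b) \<Rightarrow> bool" where
  "finer_map X q p \<longleftrightarrow> (\<forall>x\<in>topspace X. \<forall>y\<in>topspace X. q x = q y \<longrightarrow> p x = p y)"

text \<open>Meaningful only if \<open>q\<close> is finer than \<open>p\<close> and \<open>c\<close> is a value of \<open>q\<close>.\<close>

definition recode :: "'x topology \<Rightarrow> ('x \<Rightarrow> 'b) \<Rightarrow> ('x \<Rightarrow> 'a) \<Rightarrow> 'a \<Rightarrow> 'b" where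
  "recode X p q c = p (SOME x. x \<in> topspace X \<and> q x = c)"

definition recode_config ::
    "('g, 'm) monoid_scheme \<Rightarrow> 'x topology \<Rightarrow> ('x \<Rightarrow> 'b) \<Rightarrow> ('x \<Rightarrow> 'a)
      \<Rightarrow> ('g \<Rightarrow> 'a) \<Rightarrow> 'g \<Rightarrow> 'b" where
  "recode_config G X p q u = (\<lambda>g\<in>carrier G. recode X p q (u g))"

text \<open>The chosen representative may differ from \<open>x\<close>, but it has the same
  \<open>q\<close>-value, and \<open>p\<close> is constant on fibres of \<open>q\<close>.\<close>

lemma recode_apply:
  assumes "finer_map X q p" "x \<in> topspace X"
  shows "recode X p q (q x) = p x"
proof -
  let ?y = "SOME y. y \<in> topspace X \<and> q y = q x"
  have "?y \<in> topspace X \<and> q ?y = q x"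
    by (rule someI[of "\<lambda>y. y \<in> topspace X \<and> q y = q x" x]) (use assms(2) in simp)
  then show ?thesis using assms unfolding recode_def finer_map_def by blast
qed

locale generated_system = group G for G :: "('g, 'm) monoid_scheme" (structure) +
  fixes X :: "'x topology" and \<Phi> :: "'g \<Rightarrow> 'x \<Rightarrow> 'x" and S :: "'g set"
  assumes generator: "finite_generator G S" and system: "dynamical_system G X \<Phi>"
begin

lemma finite_S: "finite S" and S_carrier: "S \<subseteq> carrier G"
  using generator unfolding finite_generator_def by auto

lemma compact_X: "compact_space X" and Hausdorff_X: "Hausdorff_space X"
  using system unfolding dynamical_system_def by auto

lemma continuous_act: "g \<in> carrier G \<Longrightarrow> continuous_map X X (\<Phi> g)"
  using system unfolding dynamical_system_def by (blast intro: homeomorphic_imp_continuous_map)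

lemma act_closed: "g \<in> carrier G \<Longrightarrow> x \<in> topspace X \<Longrightarrow> \<Phi> g x \<in> topspace X"
  using continuous_act by (auto simp: continuous_map_def)

lemma act_one: "x \<in> topspace X \<Longrightarrow> \<Phi> \<one> x = x"
  using system unfolding dynamical_system_def by blast

lemma act_mult:
  "g \<in> carrier G \<Longrightarrow> h \<in> carrier G \<Longrightarrow> x \<in> topspace X \<Longrightarrow> \<Phi> (g \<otimes> h) x = \<Phi> g (\<Phi> h x)"
  using system unfolding dynamical_system_def by blast

lemma continuous_map_discrete_act:
  assumes "continuous_map X (discrete_topology UNIV) q" "g \<in> carrier G"
  shows "continuous_map X (discrete_topology UNIV) (\<lambda>x. q (\<Phi> g x))"
  using continuous_map_compose[OF continuous_act[OF assms(2)] assms(1)] by (simp add: o_def)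

lemma itinerary_shift_value:
  assumes "u \<in> itinerary_shift G X \<Phi> S q" "g \<in> carrier G"
  obtains x where "x \<in> topspace X" "u g = q x"
proof -
  have "u \<in> carrier G \<rightarrow>\<^sub>E q ` topspace X" using assms(1) unfolding itinerary_shift_def by blast
  from PiE_mem[OF this assms(2)] show ?thesis using that by blast
qed

text \<open>The orbit point \<open>\<Phi> g x\<close> realises all transitions at \<open>g\<close>
  simultaneously.\<close>

lemma itinerary_in_shift:
  assumes "x \<in> topspace X"
  shows "itinerary G \<Phi> q x \<in> itinerary_shift G X \<Phi> S q"
proof -
  have "\<exists>y\<in>topspace X. q y = itinerary G \<Phi> q x g \<and> q (\<Phi> s y) = itinerary G \<Phi> q x (s \<otimes> g)"
    if "g \<in> carrier G" "s \<in> S" for g s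
    using that assms S_carrier act_closed act_mult
    by (intro bexI[of _ "\<Phi> g x"]) (auto simp: itinerary_def subset_iff)
  then show ?thesis
    using assms act_closed unfolding itinerary_shift_def by (auto simp: itinerary_def)
qed

lemma itinerary_act:
  assumes "x \<in> topspace X" "g \<in> carrier G"
  shows "itinerary G \<Phi> q (\<Phi> g x) = shift_act G g (itinerary G \<Phi> q x)"
  using assms act_mult by (auto simp: itinerary_def shift_act_def)

text \<open>Each constraint involves only the two letters at \<open>g\<close> and
  \<open>s g\<close>, hence is closed. Read from \<open>g\<close>, these positions are
  \<open>\<one>\<close> and \<open>s\<close>, so forbidden patterns on the finite window
  \<open>insert \<one> S\<close> suffice.\<close>

lemma shift_of_finite_type_itinerary_shift:
  fixes q :: "'x \<Rightarrow> 'a"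
  assumes "finite (q ` topspace X)"
  shows "shift_of_finite_type G (q ` topspace X) (itinerary_shift G X \<Phi> S q)"
proof -
  let ?\<Sigma> = "q ` topspace X" and ?Y = "itinerary_shift G X \<Phi> S q"
  let ?ok = "\<lambda>s a b. \<exists>x\<in>topspace X. q x = a \<and> q (\<Phi> s x) = b"
  have "subshift G ?\<Sigma> (carrier G \<rightarrow>\<^sub>E ?\<Sigma>)"
    using assms closedin_topspace[of "full_shift G ?\<Sigma>"]
    by (auto simp: subshift_def full_shift_def shift_act_def PiE_iff)
  moreover have full: "subshift_space G ?\<Sigma> (carrier G \<rightarrow>\<^sub>E ?\<Sigma>) = full_shift G ?\<Sigma>"
    unfolding subshift_space_def using subtopology_topspace[of "full_shift G ?\<Sigma>"]
    by (simp add: full_shift_def)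
  ultimately have coord: "continuous_map (full_shift G ?\<Sigma>) (discrete_topology UNIV) (\<lambda>u. u g)"
    if "g \<in> carrier G" for g
    using continuous_map_subshift_coordinate that by metis
  have top: "topspace (full_shift G ?\<Sigma>) = carrier G \<rightarrow>\<^sub>E ?\<Sigma>" unfolding full_shift_def by simp
  have closed: "closedin (full_shift G ?\<Sigma>) ?Y"
  proof -
    have clo: "closedin (full_shift G ?\<Sigma>)
        {u \<in> topspace (full_shift G ?\<Sigma>). ?ok s (u g) (u (s \<otimes> g)) = True}"
      if g: "g \<in> carrier G" and s: "s \<in> S" for g s
    proof (rule closedin_level_set, rule continuous_map_discrete_factor)
      have sg: "s \<otimes> g \<in> carrier G" using g s S_carrier by blast
      show "continuous_map (full_shift G ?\<Sigma>) (discrete_topology UNIV)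
          (\<lambda>u. restrict u {g, s \<otimes> g})"
        using coord g sg by (intro continuous_map_discrete_restrict) auto
      show "?ok s (u g) (u (s \<otimes> g)) = ?ok s (v g) (v (s \<otimes> g))"
        if "restrict u {g, s \<otimes> g} = restrict v {g, s \<otimes> g}" for u v :: "'g \<Rightarrow> 'a"
        using fun_cong[OF that, of g] fun_cong[OF that, of "s \<otimes> g"] by simp
    qed
    let ?C = "\<lambda>(g, s). {u \<in> topspace (full_shift G ?\<Sigma>). ?ok s (u g) (u (s \<otimes> g)) = True}"
    \<comment> \<open>The whole space is intersected explicitly: for empty \<open>S\<close> there is
      no constraint, and an intersection over no sets would not be the full shift.\<close>
    have "?Y = topspace (full_shift G ?\<Sigma>) \<inter> (\<Inter>p\<in>carrier G \<times> S. ?C p)"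
      unfolding itinerary_shift_def top by auto
    moreover have "closedin (full_shift G ?\<Sigma>) (\<Inter>p\<in>carrier G \<times> S. ?C p)" if "S \<noteq> {}"
      using that clo by (intro closedin_INT) auto
    ultimately show ?thesis
      by (cases "S = {}") auto
  qed
  have "shift_act G h u \<in> ?Y" if h: "h \<in> carrier G" and u: "u \<in> ?Y" for h u
  proof -
    have "?ok s (shift_act G h u g) (shift_act G h u (s \<otimes> g))" if "g \<in> carrier G" "s \<in> S" for g s
    proof -
      have "?ok s (u (g \<otimes> h)) (u (s \<otimes> (g \<otimes> h)))"
        using u h that unfolding itinerary_shift_def by blast
      then show ?thesis
        using h that S_carrier by (simp add: shift_act_def m_assoc subset_iff)
    qed
    moreover have "shift_act G h u \<in> carrier G \<rightarrow>\<^sub>E ?\<Sigma>"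
      using u h unfolding itinerary_shift_def by (auto simp: shift_act_def PiE_iff)
    ultimately show ?thesis unfolding itinerary_shift_def by blast
  qed
  then have sub: "subshift G ?\<Sigma> ?Y" unfolding subshift_def using assms closed by blast
  let ?A = "insert \<one> S"
  let ?F = "{P \<in> ?A \<rightarrow>\<^sub>E ?\<Sigma>. \<exists>s\<in>S. \<not> ?ok s (P \<one>) (P s)}"
  have A: "?A \<subseteq> carrier G" using S_carrier by auto
  have step: "shift_act G g u s = u (s \<otimes> g)" "shift_act G g u \<one> = u g"
    if "g \<in> carrier G" "s \<in> carrier G" for g s and u :: "'g \<Rightarrow> 'a"
    using that by (auto simp: shift_act_def)
  have "?Y = {x \<in> carrier G \<rightarrow>\<^sub>E ?\<Sigma>. \<forall>g\<in>carrier G. \<forall>P\<in>?F. shift_act G g x \<notin> cylinder G ?\<Sigma> ?A P}"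
    (is "_ = ?R")
  proof (intro subset_antisym subsetI)
    fix u assume u: "u \<in> ?Y"
    have "shift_act G g u \<notin> cylinder G ?\<Sigma> ?A P" if g: "g \<in> carrier G" and P: "P \<in> ?F" for g P
    proof
      assume "shift_act G g u \<in> cylinder G ?\<Sigma> ?A P"
      then have cyl: "shift_act G g u a = P a" if "a \<in> ?A" for a
        using that unfolding cylinder_def by blast
      obtain s where s: "s \<in> S" "\<not> ?ok s (P \<one>) (P s)" using P by blast
      have "P \<one> = u g" "P s = u (s \<otimes> g)"
        using cyl[of \<one>] cyl[of s] step[OF g, of s] s(1) S_carrier by auto
      moreover have "?ok s (u g) (u (s \<otimes> g))"
        using u g s(1) unfolding itinerary_shift_def by blast
      ultimately show False using s(2) by simp
    qed
    then show "u \<in> ?R" using u unfolding itinerary_shift_def by blast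
  next
    fix u assume u: "u \<in> ?R"
    have "?ok s (u g) (u (s \<otimes> g))" if g: "g \<in> carrier G" and s: "s \<in> S" for g s
    proof (rule ccontr)
      assume neg: "\<not> ?ok s (u g) (u (s \<otimes> g))"
      \<comment> \<open>Were the transition at \<open>g\<close> not realised, the pattern of
        \<open>u\<close> around \<open>g\<close> would itself be forbidden.\<close>
      let ?P = "restrict (shift_act G g u) ?A"
      have act: "shift_act G g u \<in> carrier G \<rightarrow>\<^sub>E ?\<Sigma>"
        using u g by (auto simp: shift_act_def PiE_iff)
      then have "?P \<in> ?A \<rightarrow>\<^sub>E ?\<Sigma>" using A by (auto simp: PiE_iff)
      moreover have "?P \<one> = u g" "?P s = u (s \<otimes> g)"
        using step[OF g, of s] s S_carrier by auto
      ultimately have "?P \<in> ?A \<rightarrow>\<^sub>E ?\<Sigma> \<and> \<not> ?ok s (?P \<one>) (?P s)" using neg by (simp only:) simp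
      then have "?P \<in> ?F" using s by blast
      moreover have "shift_act G g u \<in> cylinder G ?\<Sigma> ?A ?P"
        using act unfolding cylinder_def by simp
      ultimately show False using u g by blast
    qed
    then show "u \<in> ?Y" using u unfolding itinerary_shift_def by blast
  qed
  moreover have "finite ?A" using finite_S by simp
  ultimately show ?thesis
    unfolding shift_of_finite_type_def using sub A by (intro conjI exI[of _ ?A] exI[of _ ?F]) auto
qed

section \<open>Recoding maps between itinerary shifts\<close>

lemma recode_config_itinerary:
  assumes "finer_map X q p" "x \<in> topspace X"
  shows "recode_config G X p q (itinerary G \<Phi> q x) = itinerary G \<Phi> p x"
  using assms act_closed recode_apply[OF assms(1)]
  by (auto simp: recode_config_def itinerary_def)

text \<open>A point that realises a transition for \<open>q\<close> also realises the recoded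
  transition for \<open>p\<close>.\<close>

lemma recode_config_in_shift:
  assumes f: "finer_map X q p" and u: "u \<in> itinerary_shift G X \<Phi> S q"
  shows "recode_config G X p q u \<in> itinerary_shift G X \<Phi> S p"
proof -
  have "recode X p q (u g) \<in> p ` topspace X" if g: "g \<in> carrier G" for g
  proof -
    obtain x where "x \<in> topspace X" "u g = q x" using itinerary_shift_value[OF u g] .
    then show ?thesis using recode_apply[OF f] by simp
  qed
  moreover have "\<exists>x\<in>topspace X. p x = recode_config G X p q u g \<and>
      p (\<Phi> s x) = recode_config G X p q u (s \<otimes> g)"
    if g: "g \<in> carrier G" and s: "s \<in> S" for g s
  proof -
    obtain x where x: "x \<in> topspace X" "q x = u g" "q (\<Phi> s x) = u (s \<otimes> g)"
      using u g s unfolding itinerary_shift_def by blast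
    have "s \<in> carrier G" using s S_carrier by blast
    then have "recode X p q (u g) = p x" "recode X p q (u (s \<otimes> g)) = p (\<Phi> s x)"
      using recode_apply[OF f x(1)] recode_apply[OF f act_closed[of s x]] x by auto
    then show ?thesis
      using x(1) g \<open>s \<in> carrier G\<close> by (intro bexI[of _ x]) (auto simp: recode_config_def)
  qed
  ultimately show ?thesis
    unfolding itinerary_shift_def by (auto simp: recode_config_def)
qed

lemma recode_config_comp:
  assumes "finer_map X q p" "finer_map X r q" "u \<in> itinerary_shift G X \<Phi> S r"
  shows "recode_config G X p r u = recode_config G X p q (recode_config G X q r u)"
proof
  fix g
  have "recode X p r (u g) = recode X p q (recode X q r (u g))" if g: "g \<in> carrier G"
  proof -
    obtain x where x: "x \<in> topspace X" "u g = r x"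
      using itinerary_shift_value[OF assms(3) g] .
    have "finer_map X r p" using assms(1,2) act_closed unfolding finer_map_def by blast
    then show ?thesis using x assms by (simp add: recode_apply)
  qed
  then show "recode_config G X p r u g
      = recode_config G X p q (recode_config G X q r u) g"
    by (simp add: recode_config_def)
qed

lemma recode_config_id:
  assumes "u \<in> itinerary_shift G X \<Phi> S q"
  shows "recode_config G X q q u = u"
proof
  fix g
  have f: "finer_map X q q" unfolding finer_map_def by blast
  have "recode X q q (u g) = u g" if "g \<in> carrier G"
    by (rule itinerary_shift_value[OF assms that]) (simp add: recode_apply[OF f])
  then show "recode_config G X q q u g = u g"
    using assms unfolding itinerary_shift_def by (auto simp: recode_config_def PiE_iff extensional_def)
qed

lemma continuous_map_recode_config:
  assumes q: "finite (q ` topspace X)" and p: "finite (p ` topspace X)" and f: "finer_map X q p"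
  shows "continuous_map (subshift_space G (q ` topspace X) (itinerary_shift G X \<Phi> S q))
           (subshift_space G (p ` topspace X) (itinerary_shift G X \<Phi> S p)) (recode_config G X p q)"
proof -
  have sub: "subshift G (r ` topspace X) (itinerary_shift G X \<Phi> S r)"
    if "finite (r ` topspace X)" for r :: "'x \<Rightarrow> 'z"
    using shift_of_finite_type_itinerary_shift[OF that] unfolding shift_of_finite_type_def by blast
  show ?thesis
  proof (rule continuous_map_into_subshift[OF sub[OF p]])
    show "recode_config G X p q z \<in> itinerary_shift G X \<Phi> S p"
      if "z \<in> topspace (subshift_space G (q ` topspace X) (itinerary_shift G X \<Phi> S q))" for z
      using that recode_config_in_shift[OF f] sub[OF q] by simp
    show "continuous_map (subshift_space G (q ` topspace X) (itinerary_shift G X \<Phi> S q))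
        (discrete_topology UNIV) (\<lambda>z. recode_config G X p q z g)" if g: "g \<in> carrier G" for g
      by (rule continuous_map_discrete_factor[OF continuous_map_subshift_coordinate[OF sub[OF q] g]])
        (use g in \<open>simp add: recode_config_def\<close>)
  qed
qed

lemma shift_act_recode_config:
  assumes "g \<in> carrier G"
  shows "shift_act G g (recode_config G X p q u) = recode_config G X p q (shift_act G g u)"
  using assms by (auto simp: recode_config_def shift_act_def)

text \<open>Points \<open>x g\<close> with codes \<open>u g\<close> form a pseudo-orbit once
  \<open>r\<close> is fine enough, and a point shadowing it up to fibres of \<open>p\<close> has the
  recoded \<open>u\<close> as its itinerary. Quantifying over all sufficiently fine \<open>r\<close>
  gives stabilisation at every later index of the inverse system.\<close>

lemma shadowing_traces_itinerary_shift:
  fixes q :: "'i \<Rightarrow> 'x \<Rightarrow> 'a" and p :: "'x \<Rightarrow> 'b"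
  assumes sh: "shadowing_property G X \<Phi> S" and I: "I \<noteq> {}"
    and cont: "\<And>i. i \<in> I \<Longrightarrow> continuous_map X (discrete_topology UNIV) (q i)"
    and dir: "\<And>i j. i \<in> I \<Longrightarrow> j \<in> I \<Longrightarrow> \<exists>k\<in>I. \<forall>x\<in>topspace X. \<forall>y\<in>topspace X.
                 q k x = q k y \<longrightarrow> q i x = q i y \<and> q j x = q j y"
    and sep: "\<And>x y. x \<in> topspace X \<Longrightarrow> y \<in> topspace X \<Longrightarrow> x \<noteq> y \<Longrightarrow> \<exists>i\<in>I. q i x \<noteq> q i y"
    and p: "continuous_map X (discrete_topology UNIV) p"
  shows "\<exists>i\<in>I. \<forall>(r :: 'x \<Rightarrow> 'a) u. finer_map X r (q i) \<longrightarrow> finer_map X r p \<longrightarrow>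
           u \<in> itinerary_shift G X \<Phi> S r \<longrightarrow>
           (\<exists>z\<in>topspace X. recode_config G X p r u = itinerary G \<Phi> p z)"
proof -
  let ?\<U> = "(\<lambda>x. {y \<in> topspace X. p y = p x}) ` topspace X"
  obtain \<V> where \<V>: "finite_open_cover X \<V>"
    and shad: "\<And>x. pseudo_orbit G X \<Phi> S \<V> x \<Longrightarrow> \<exists>z\<in>topspace X. shadows G \<Phi> ?\<U> z x"
    using sh finite_open_cover_level_sets[OF compact_X p] unfolding shadowing_property_def by meson
  have "\<exists>i\<in>I. \<forall>x\<in>topspace X. \<exists>U\<in>\<V>. \<forall>y\<in>topspace X. q i y = q i x \<longrightarrow> y \<in> U"
    by (rule level_sets_refine_cover[OF compact_X I cont dir sep])
      (use \<V> in \<open>auto simp: finite_open_cover_def\<close>)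
  then obtain n where n: "n \<in> I"
    and "\<forall>x\<in>topspace X. \<exists>U\<in>\<V>. \<forall>y\<in>topspace X. q n y = q n x \<longrightarrow> y \<in> U" by (rule bexE)
  \<comment> \<open>\<open>V x\<close> is a member of the cover that contains the whole
    \<open>q n\<close>-fibre of \<open>x\<close>, so equal \<open>q n\<close>-values imply closeness
    with respect to \<open>\<V>\<close>.\<close>
  from bchoice[OF this(2)[unfolded Bex_def]] obtain V where
    V: "\<And>x. x \<in> topspace X \<Longrightarrow> V x \<in> \<V>"
      "\<And>x y. x \<in> topspace X \<Longrightarrow> y \<in> topspace X \<Longrightarrow> q n y = q n x \<Longrightarrow> y \<in> V x"
    by auto
  \<comment> \<open>A transition of \<open>u\<close> is realised by a point that shares only its
    code with \<open>x g\<close>. To control \<open>\<Phi> s (x g)\<close>, the code must therefore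
    determine \<open>q n\<close> after every generator; the entry at \<open>\<one>\<close> retains
    \<open>q n\<close> of the point itself.\<close>
  let ?R = "\<lambda>x. restrict (\<lambda>s. q n (\<Phi> s x)) (insert \<one> S)"
  have "continuous_map X (discrete_topology UNIV) ?R"
  proof (rule continuous_map_discrete_restrict)
    show "continuous_map X (discrete_topology UNIV) (\<lambda>x. q n (\<Phi> s x))" if "s \<in> insert \<one> S" for s
      using that S_carrier by (intro continuous_map_discrete_act cont n) auto
  qed (simp add: finite_S)
  from locally_constant_factor[OF compact_X I cont dir sep this]
  obtain i where i: "i \<in> I"
    and fine: "\<And>x y. x \<in> topspace X \<Longrightarrow> y \<in> topspace X \<Longrightarrow> q i x = q i y \<Longrightarrow> ?R x = ?R y"
    by blast
  have fine_S: "q n (\<Phi> s x) = q n (\<Phi> s y)"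
    if "x \<in> topspace X" "y \<in> topspace X" "q i x = q i y" "s \<in> insert \<one> S" for x y s
    using fun_cong[OF fine[OF that(1-3)], of s] that(4) by simp
  show ?thesis
  proof (intro bexI[OF _ i] allI impI)
    fix r :: "'x \<Rightarrow> 'a" and u
    assume ri: "finer_map X r (q i)" and rp: "finer_map X r p"
      and u: "u \<in> itinerary_shift G X \<Phi> S r"
    have r_S: "q n (\<Phi> s x) = q n (\<Phi> s y)"
      if "x \<in> topspace X" "y \<in> topspace X" "r x = r y" "s \<in> insert \<one> S" for x y s
      using fine_S[OF that(1,2) _ that(4)] ri that unfolding finer_map_def by blast
    have r_n: "q n x = q n y" if "x \<in> topspace X" "y \<in> topspace X" "r x = r y" for x y
      using r_S[OF that, of \<one>] that act_one by simp
    have "\<forall>g\<in>carrier G. \<exists>x. x \<in> topspace X \<and> r x = u g"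
      using itinerary_shift_value[OF u] by metis
    then obtain x where x: "\<And>g. g \<in> carrier G \<Longrightarrow> x g \<in> topspace X"
      "\<And>g. g \<in> carrier G \<Longrightarrow> r (x g) = u g"
      using bchoice by metis
    have step: "q n (\<Phi> s (x g)) = q n (x (s \<otimes> g))" if g: "g \<in> carrier G" and s: "s \<in> S" for g s
    proof -
      have sG: "s \<in> carrier G" using s S_carrier by blast
      obtain y where y: "y \<in> topspace X" "r y = u g" "r (\<Phi> s y) = u (s \<otimes> g)"
        using u g s unfolding itinerary_shift_def by blast
      \<comment> \<open>The point \<open>y\<close> realising the transition has the code of
        \<open>x g\<close>, hence the same \<open>q n\<close>-value after \<open>s\<close>; and
        \<open>\<Phi> s y\<close> has the code of \<open>x (s g)\<close>.\<close>
      have "q n (\<Phi> s (x g)) = q n (\<Phi> s y)"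
        by (rule r_S) (use x[OF g] y s in auto)
      also have "\<dots> = q n (x (s \<otimes> g))"
        by (rule r_n) (use x[of "s \<otimes> g"] y g sG act_closed in auto)
      finally show ?thesis .
    qed
    have "pseudo_orbit G X \<Phi> S \<V> x"
      unfolding pseudo_orbit_def
    proof (intro conjI exI[of _ "\<lambda>g. V (x g)"] ballI)
      fix g s assume g: "g \<in> carrier G" and s: "s \<in> S"
      have sG: "s \<in> carrier G" using s S_carrier by blast
      show "x (s \<otimes> g) \<in> V (x (s \<otimes> g))" using V(2) x g sG by simp
      show "\<Phi> s (x g) \<in> V (x (s \<otimes> g))"
        using V(2)[OF x(1) act_closed[OF sG x(1)[OF g]] step[OF g s]] g sG by simp
    qed (use x V(1) in auto)
    then obtain z where z: "z \<in> topspace X" "shadows G \<Phi> ?\<U> z x" using shad by blast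
    have "recode X p r (u g) = p (\<Phi> g z)" if g: "g \<in> carrier G" for g
    proof -
      obtain U where "U \<in> ?\<U>" "\<Phi> g z \<in> U" "x g \<in> U"
        using z(2) g unfolding shadows_def by blast
      then have "p (\<Phi> g z) = p (x g)" by auto
      then show ?thesis using recode_apply[OF rp x(1)[OF g]] x(2)[OF g] by simp
    qed
    then have "recode_config G X p r u = itinerary G \<Phi> p z"
      unfolding recode_config_def itinerary_def by (intro restrict_ext)
    then show "\<exists>z\<in>topspace X. recode_config G X p r u = itinerary G \<Phi> p z"
      using z(1) by blast
  qed
qed

end


section \<open>Coding a totally disconnected space by clopen sets\<close>

text \<open>The families need not be partitions or covers; a partition arises by grouping points
  that lie in the same members. Arbitrary finite families have unions as upper bounds, so inclusion
  directs them.\<close>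

definition clopen_families :: "'x topology \<Rightarrow> 'x set set set" where
  "clopen_families X = {\<C>. finite \<C> \<and> (\<forall>C\<in>\<C>. openin X C \<and> closedin X C)}"

text \<open>Numbering the membership patterns lets all indices share the letter type
  \<open>nat\<close>. For finite families the numbering is injective.\<close>

definition clopen_code :: "'x set set \<Rightarrow> 'x \<Rightarrow> nat" where
  "clopen_code \<C> x = to_nat_on (Pow \<C>) {C \<in> \<C>. x \<in> C}"

lemma clopen_code_eq_iff:
  assumes "\<C> \<in> clopen_families X"
  shows "clopen_code \<C> x = clopen_code \<C> y \<longleftrightarrow> (\<forall>C\<in>\<C>. x \<in> C \<longleftrightarrow> y \<in> C)"
proof -
  have "countable (Pow \<C>)"
    using assms by (simp add: clopen_families_def countable_finite)
  then have "clopen_code \<C> x = clopen_code \<C> y \<longleftrightarrow> {C \<in> \<C>. x \<in> C} = {C \<in> \<C>. y \<in> C}"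
    unfolding clopen_code_def by (subst to_nat_on_inj) auto
  then show ?thesis by blast
qed

lemma continuous_map_clopen_code:
  assumes "\<C> \<in> clopen_families X"
  shows "continuous_map X (discrete_topology UNIV) (clopen_code \<C>)"
proof (rule continuous_map_discrete_factor)
  show "continuous_map X (discrete_topology UNIV) (\<lambda>x. restrict (\<lambda>C. x \<in> C) \<C>)"
  proof (rule continuous_map_discrete_restrict)
    show "finite \<C>" using assms unfolding clopen_families_def by blast
    show "continuous_map X (discrete_topology UNIV) (\<lambda>x. x \<in> C)" if "C \<in> \<C>" for C
      unfolding continuous_map_discrete_iff
    proof
      fix x
      have C: "openin X C" "closedin X C" using assms that unfolding clopen_families_def by auto
      have "{y \<in> topspace X. (y \<in> C) = (x \<in> C)} = (if x \<in> C then C else topspace X - C)"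
        using openin_subset[OF C(1)] by auto
      then show "openin X {y \<in> topspace X. (y \<in> C) = (x \<in> C)}" using C by auto
    qed
  qed
  show "clopen_code \<C> x = clopen_code \<C> y"
    if "restrict (\<lambda>C. x \<in> C) \<C> = restrict (\<lambda>C. y \<in> C) \<C>" for x y
    unfolding clopen_code_eq_iff[OF assms] using that by (metis restrict_apply')
qed

lemma finer_map_clopen_code:
  assumes "\<C> \<in> clopen_families X" "\<D> \<in> clopen_families X" "\<C> \<subseteq> \<D>"
  shows "finer_map X (clopen_code \<D>) (clopen_code \<C>)"
  unfolding finer_map_def clopen_code_eq_iff[OF assms(1)] clopen_code_eq_iff[OF assms(2)]
  using assms(3) by blast

lemma clopen_families_Un:
  "\<C> \<in> clopen_families X \<Longrightarrow> \<D> \<in> clopen_families X \<Longrightarrow> \<C> \<union> \<D> \<in> clopen_families X"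
  unfolding clopen_families_def by blast

lemma clopen_code_separates:
  assumes "compact_space X" "Hausdorff_space X" "totally_disconnected_space X"
    and "x \<in> topspace X" "y \<in> topspace X" "x \<noteq> y"
  shows "\<exists>\<C>\<in>clopen_families X. clopen_code \<C> x \<noteq> clopen_code \<C> y"
proof -
  obtain T where T: "openin X T" "closedin X T" "x \<in> T" "y \<notin> T"
    using clopen_separation[OF assms] by blast
  then have "{T} \<in> clopen_families X" unfolding clopen_families_def by simp
  moreover from this have "clopen_code {T} x \<noteq> clopen_code {T} y"
    using T by (simp add: clopen_code_eq_iff)
  ultimately show ?thesis by blast
qed

section \<open>A Mittag-Leffler presentation from shadowing\<close>

proposition (in generated_system) limit_of_SFTs_if_shadowing:
  assumes td: "totally_disconnected_space X" and sh: "shadowing_property G X \<Phi> S"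
  shows "conjugate_to_ML_limit_of_SFTs TYPE('x set set) TYPE(nat) G X \<Phi>"
proof -
  let ?\<Lambda> = "clopen_families X" and ?q = "clopen_code :: 'x set set \<Rightarrow> 'x \<Rightarrow> nat"
  let ?\<Sigma> = "\<lambda>i. ?q i ` topspace X" and ?Y = "\<lambda>i. itinerary_shift G X \<Phi> S (?q i)"
  let ?\<phi> = "\<lambda>i j. recode_config G X (?q i) (?q j)"
  let ?Z = "\<lambda>i. subshift_space G (?\<Sigma> i) (?Y i)"
  let ?L = "inverse_limit_space ?\<Lambda> (\<subseteq>) ?Z ?\<phi>"
  have ne: "?\<Lambda> \<noteq> {}" unfolding clopen_families_def by blast
  have fin: "finite (?\<Sigma> i)" if "i \<in> ?\<Lambda>" for i
    using finite_image_continuous_map_discrete[OF compact_X continuous_map_clopen_code[OF that]] .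
  have sft: "shift_of_finite_type G (?\<Sigma> i) (?Y i)" if "i \<in> ?\<Lambda>" for i
    using shift_of_finite_type_itinerary_shift[OF fin[OF that]] .
  then have sub: "subshift G (?\<Sigma> i) (?Y i)" if "i \<in> ?\<Lambda>" for i
    using that unfolding shift_of_finite_type_def by blast
  have top: "topspace (?Z i) = ?Y i" if "i \<in> ?\<Lambda>" for i
    using sub[OF that] by simp
  have dir: "\<exists>k\<in>?\<Lambda>. \<forall>x\<in>topspace X. \<forall>y\<in>topspace X.
      ?q k x = ?q k y \<longrightarrow> ?q i x = ?q i y \<and> ?q j x = ?q j y" if ij: "i \<in> ?\<Lambda>" "j \<in> ?\<Lambda>" for i j
  proof (intro bexI[OF _ clopen_families_Un[OF ij]] ballI impI)
    fix x y assume "x \<in> topspace X" "y \<in> topspace X" "?q (i \<union> j) x = ?q (i \<union> j) y"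
    then have "?q k x = ?q k y" if "k \<in> ?\<Lambda>" "k \<subseteq> i \<union> j" for k
      using finer_map_clopen_code[OF that(1) clopen_families_Un[OF ij] that(2)]
      unfolding finer_map_def by blast
    then show "?q i x = ?q i y \<and> ?q j x = ?q j y" using ij by simp
  qed
  note sep = clopen_code_separates[OF compact_X Hausdorff_X td]
  \<comment> \<open>Besides stabilisation this identifies the stable image as the set of true
    itineraries. The first gives the Mittag-Leffler condition, the second the surjectivity of
    \<open>?h\<close>.\<close>
  have trace: "\<exists>j\<in>?\<Lambda>. i \<subseteq> j \<and> (\<forall>k\<in>?\<Lambda>. j \<subseteq> k \<longrightarrow>
      ?\<phi> i k ` ?Y k = itinerary G \<Phi> (?q i) ` topspace X)" if i: "i \<in> ?\<Lambda>" for i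
  proof -
    have "\<exists>n\<in>?\<Lambda>. \<forall>(r :: 'x \<Rightarrow> nat) u. finer_map X r (?q n) \<longrightarrow> finer_map X r (?q i) \<longrightarrow>
        u \<in> itinerary_shift G X \<Phi> S r \<longrightarrow>
        (\<exists>z\<in>topspace X. recode_config G X (?q i) r u = itinerary G \<Phi> (?q i) z)"
      by (rule shadowing_traces_itinerary_shift[OF sh ne continuous_map_clopen_code dir sep
            continuous_map_clopen_code[OF i]])
    then obtain n where n: "n \<in> ?\<Lambda>" and tr: "\<forall>(r :: 'x \<Rightarrow> nat) u. finer_map X r (?q n) \<longrightarrow> finer_map X r (?q i) \<longrightarrow>
        u \<in> itinerary_shift G X \<Phi> S r \<longrightarrow>
        (\<exists>z\<in>topspace X. recode_config G X (?q i) r u = itinerary G \<Phi> (?q i) z)"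
      by (rule bexE)
    \<comment> \<open>Including \<open>i\<close> makes recoding to \<open>?q i\<close> meaningful,
      and including \<open>n\<close> makes \<open>k\<close> fine enough for shadowing. Conversely,
      itineraries at \<open>i\<close> are recoded itineraries at \<open>k\<close>.\<close>
    have "?\<phi> i k ` ?Y k = itinerary G \<Phi> (?q i) ` topspace X"
      if k: "k \<in> ?\<Lambda>" "i \<union> n \<subseteq> k" for k
    proof (intro subset_antisym subsetI)
      have fn: "finer_map X (?q k) (?q n)" and fi: "finer_map X (?q k) (?q i)"
        using finer_map_clopen_code[OF n k(1)] finer_map_clopen_code[OF i k(1)] k(2) by auto
      show "v \<in> itinerary G \<Phi> (?q i) ` topspace X" if "v \<in> ?\<phi> i k ` ?Y k" for v
        using that tr fn fi by blast
      show "v \<in> ?\<phi> i k ` ?Y k" if "v \<in> itinerary G \<Phi> (?q i) ` topspace X" for v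
      proof -
        obtain z where z: "z \<in> topspace X" "v = itinerary G \<Phi> (?q i) z" using \<open>v \<in> _\<close> by blast
        show ?thesis
          unfolding z(2) recode_config_itinerary[OF fi z(1), symmetric]
          by (rule imageI[OF itinerary_in_shift[OF z(1)]])
      qed
    qed
    then show ?thesis
      by (intro bexI[OF _ clopen_families_Un[OF i n]]) auto
  qed
  have inv: "inverse_system G ?\<Lambda> (\<subseteq>) ?Z (\<lambda>_. shift_act G) ?\<phi>"
    unfolding inverse_system_def
  proof (intro conjI ballI impI)
    show "directed_index_set ?\<Lambda> (\<subseteq>)"
      unfolding directed_index_set_def
    proof (intro conjI ballI impI ne)
      show "\<exists>k\<in>?\<Lambda>. i \<subseteq> k \<and> j \<subseteq> k" if "i \<in> ?\<Lambda>" "j \<in> ?\<Lambda>" for i j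
        by (intro bexI[OF _ clopen_families_Un[OF that]]) simp
    qed auto
    show "dynamical_system G (?Z i) (shift_act G)" if "i \<in> ?\<Lambda>" for i
      using dynamical_system_subshift[OF is_group sub[OF that]] .
    show "continuous_map (?Z j) (?Z i) (?\<phi> i j)" if "i \<in> ?\<Lambda>" "j \<in> ?\<Lambda>" "i \<subseteq> j" for i j
      by (rule continuous_map_recode_config[OF fin[OF that(2)] fin[OF that(1)]
            finer_map_clopen_code[OF that]])
    show "?\<phi> i i x = x" if "i \<in> ?\<Lambda>" "x \<in> topspace (?Z i)" for i x
      using that top by (simp add: recode_config_id)
    show "?\<phi> i k x = ?\<phi> i j (?\<phi> j k x)"
      if "i \<in> ?\<Lambda>" "j \<in> ?\<Lambda>" "k \<in> ?\<Lambda>" "i \<subseteq> j" "j \<subseteq> k" "x \<in> topspace (?Z k)" for i j k x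
      using that top by (intro recode_config_comp finer_map_clopen_code) auto
    show "shift_act G g (?\<phi> i j x) = ?\<phi> i j (shift_act G g x)" if "g \<in> carrier G" for i j g x
      using shift_act_recode_config[OF that] .
  qed
  have ml: "mittag_leffler ?\<Lambda> (\<subseteq>) ?Z ?\<phi>"
    unfolding mittag_leffler_def
  proof
    fix i assume i: "i \<in> ?\<Lambda>"
    obtain j where j: "j \<in> ?\<Lambda>" and j': "i \<subseteq> j \<and> (\<forall>k\<in>?\<Lambda>. j \<subseteq> k \<longrightarrow>
        ?\<phi> i k ` ?Y k = itinerary G \<Phi> (?q i) ` topspace X)" using trace[OF i] by (rule bexE)
    have img: "?\<phi> i k ` topspace (?Z k) = itinerary G \<Phi> (?q i) ` topspace X"
      if "k \<in> ?\<Lambda>" "j \<subseteq> k" for k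
      using that top[OF that(1)] j' by simp
    show "\<exists>j\<in>?\<Lambda>. i \<subseteq> j \<and> (\<forall>k\<in>?\<Lambda>. j \<subseteq> k \<longrightarrow>
        ?\<phi> i k ` topspace (?Z k) = ?\<phi> i j ` topspace (?Z j))"
      by (intro bexI[OF _ j] conjI conjunct1[OF j'] ballI impI) (simp only: img j subset_refl)
  qed
  let ?h = "\<lambda>x. \<lambda>i\<in>?\<Lambda>. itinerary G \<Phi> (?q i) x"
  have topL: "topspace ?L = {u \<in> (\<Pi>\<^sub>E i\<in>?\<Lambda>. ?Y i).
      \<forall>i\<in>?\<Lambda>. \<forall>j\<in>?\<Lambda>. i \<subseteq> j \<longrightarrow> u i = ?\<phi> i j (u j)}"
    unfolding topspace_inverse_limit_space using top by (simp cong: PiE_cong)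
  have hL: "?h x \<in> topspace ?L" if x: "x \<in> topspace X" for x
    unfolding topL
    using itinerary_in_shift[OF x] recode_config_itinerary[OF finer_map_clopen_code x] by auto
  have "homeomorphic_map X ?L ?h"
  proof (rule continuous_imp_homeomorphic_map[OF _ compact_X])
    show "continuous_map X ?L ?h"
      unfolding inverse_limit_space_def continuous_map_in_subtopology continuous_map_componentwise
    proof (intro conjI ballI)
      show "?h \<in> topspace X \<rightarrow> {x \<in> (\<Pi>\<^sub>E i\<in>?\<Lambda>. topspace (?Z i)).
          \<forall>i\<in>?\<Lambda>. \<forall>j\<in>?\<Lambda>. i \<subseteq> j \<longrightarrow> x i = ?\<phi> i j (x j)}"
        using hL unfolding topspace_inverse_limit_space by blast
      show "continuous_map X (?Z i) (\<lambda>x. ?h x i)" if i: "i \<in> ?\<Lambda>" for i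
      proof (rule continuous_map_into_subshift[OF sub[OF i]])
        show "?h x i \<in> ?Y i" if "x \<in> topspace X" for x
          using itinerary_in_shift[OF that] i by simp
        show "continuous_map X (discrete_topology UNIV) (\<lambda>x. ?h x i g)" if "g \<in> carrier G" for g
          using continuous_map_discrete_act[OF continuous_map_clopen_code[OF i] that] i that
          by (simp add: itinerary_def)
      qed
    qed auto
    show "Hausdorff_space ?L"
      unfolding inverse_limit_space_def
      by (simp add: Hausdorff_space_subtopology Hausdorff_space_product_topology
          Hausdorff_subshift_space)
    show "inj_on ?h (topspace X)"
    proof (rule inj_onI, rule ccontr)
      fix x y assume x: "x \<in> topspace X" and y: "y \<in> topspace X" and eq: "?h x = ?h y"
        and "x \<noteq> y"
      then obtain i where i: "i \<in> ?\<Lambda>" "?q i x \<noteq> ?q i y" using sep by blast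
      have "itinerary G \<Phi> (?q i) x \<one> = itinerary G \<Phi> (?q i) y \<one>"
        using fun_cong[OF eq, of i] i(1) by simp
      then show False using i(2) act_one x y by (simp add: itinerary_def)
    qed
    show "?h ` topspace X = topspace ?L"
    proof (intro subset_antisym subsetI)
      fix u assume u: "u \<in> topspace ?L"
      \<comment> \<open>A preimage of \<open>u\<close> is a point with itinerary \<open>u i\<close>
        at every index \<open>i\<close>. At a single index this is one closed condition for each
        group element, and compactness combines the indices.\<close>
      define C where "C i = {z \<in> topspace X. itinerary G \<Phi> (?q i) z = u i}" for i
      have u': "u \<in> (\<Pi>\<^sub>E i\<in>?\<Lambda>. ?Y i)"
        and comp: "\<forall>i\<in>?\<Lambda>. \<forall>j\<in>?\<Lambda>. i \<subseteq> j \<longrightarrow> u i = ?\<phi> i j (u j)"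
        using u unfolding topL mem_Collect_eq by (rule conjunct1, rule conjunct2)
      have ui: "u i = ?\<phi> i j (u j)" "u j \<in> ?Y j" if "i \<in> ?\<Lambda>" "j \<in> ?\<Lambda>" "i \<subseteq> j" for i j
        using mp[OF bspec[OF bspec[OF comp that(1)] that(2)] that(3)] PiE_mem[OF u' that(2)] .
      have "\<exists>z\<in>topspace X. \<forall>i\<in>?\<Lambda>. z \<in> C i"
      proof (rule directed_closed_Inter_nonempty[OF compact_X ne])
        fix i assume i: "i \<in> ?\<Lambda>"
        have uext: "u i \<in> extensional (carrier G)"
          using ui[OF i i] subshift_subset[OF sub[OF i]] by (auto simp: PiE_def)
        have "C i = (\<Inter>g\<in>carrier G. {z \<in> topspace X. ?q i (\<Phi> g z) = u i g})"
        proof (intro subset_antisym subsetI)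
          fix z assume z: "z \<in> (\<Inter>g\<in>carrier G. {z \<in> topspace X. ?q i (\<Phi> g z) = u i g})"
          have "itinerary G \<Phi> (?q i) z = u i"
            by (rule extensionalityI[OF _ uext]) (use z in \<open>auto simp: itinerary_def\<close>)
          moreover have "z \<in> topspace X" using z one_closed by blast
          ultimately show "z \<in> C i" unfolding C_def by simp
        next
          fix z assume "z \<in> C i"
          then have z: "z \<in> topspace X" "u i = itinerary G \<Phi> (?q i) z" unfolding C_def by auto
          then show "z \<in> (\<Inter>g\<in>carrier G. {z \<in> topspace X. ?q i (\<Phi> g z) = u i g})"
            by (simp add: itinerary_def)
        qed
        also have "closedin X \<dots>"
          using carrier_not_empty
          by (intro closedin_INT closedin_level_set continuous_map_discrete_act
              continuous_map_clopen_code i) auto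
        finally show "closedin X (C i)" .
        obtain j where j: "j \<in> ?\<Lambda>" and j': "i \<subseteq> j \<and> (\<forall>k\<in>?\<Lambda>. j \<subseteq> k \<longrightarrow>
            ?\<phi> i k ` ?Y k = itinerary G \<Phi> (?q i) ` topspace X)"
          using trace[OF i] by (rule bexE)
        then have img: "?\<phi> i j ` ?Y j = itinerary G \<Phi> (?q i) ` topspace X" by simp
        note ij = conjunct1[OF j']
        \<comment> \<open>Since \<open>u\<close> is a thread, \<open>u i\<close> is the image of
          \<open>u j\<close> at a stability index \<open>j\<close>, hence the itinerary of some
          point.\<close>
        have "u i \<in> itinerary G \<Phi> (?q i) ` topspace X"
          unfolding img[symmetric] ui(1)[OF i j ij] by (rule imageI[OF ui(2)[OF i j ij]])
        then show "C i \<noteq> {}" unfolding C_def by auto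
      next
        fix i j assume ij: "i \<in> ?\<Lambda>" "j \<in> ?\<Lambda>"
        \<comment> \<open>Both \<open>u k\<close> and the itinerary at \<open>k\<close> are recoded
          from \<open>i \<union> j\<close>, so agreement there descends to \<open>k\<close>.\<close>
        have "C (i \<union> j) \<subseteq> C k" if k: "k \<in> ?\<Lambda>" "k \<subseteq> i \<union> j" for k
        proof
          fix z assume "z \<in> C (i \<union> j)"
          then have z: "z \<in> topspace X" "itinerary G \<Phi> (?q (i \<union> j)) z = u (i \<union> j)"
            unfolding C_def by auto
          have "u k = itinerary G \<Phi> (?q k) z"
            unfolding ui(1)[OF k(1) clopen_families_Un[OF ij] k(2)] z(2)[symmetric]
            by (rule recode_config_itinerary[OF _ z(1)])
              (rule finer_map_clopen_code[OF k(1) clopen_families_Un[OF ij] k(2)])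
          then show "z \<in> C k" using z(1) unfolding C_def by simp
        qed
        then show "\<exists>k\<in>?\<Lambda>. C k \<subseteq> C i \<inter> C j"
          using ij by (intro bexI[OF _ clopen_families_Un[OF ij]]) auto
      qed
      then obtain z where z: "z \<in> topspace X" "\<And>i. i \<in> ?\<Lambda> \<Longrightarrow> itinerary G \<Phi> (?q i) z = u i"
        unfolding C_def by blast
      have "u \<in> extensional ?\<Lambda>" using u' by (simp add: PiE_def)
      then have "?h z = u" by (intro extensionalityI[of _ ?\<Lambda>]) (auto simp: z(2))
      then show "u \<in> ?h ` topspace X" using z(1) by blast
    qed (use hL in auto)
  qed
  moreover have "?h (\<Phi> g x) = inverse_limit_act ?\<Lambda> (\<lambda>_. shift_act G) g (?h x)"
    if "g \<in> carrier G" "x \<in> topspace X" for g x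
    unfolding inverse_limit_act_def using itinerary_act[OF that(2,1)] by (intro restrict_ext) simp
  ultimately have con: "conjugate_systems G X \<Phi> ?L (inverse_limit_act ?\<Lambda> (\<lambda>_. shift_act G))"
    unfolding conjugate_systems_def by (intro exI[of _ ?h] conjI ballI)
  have "SFT_ML_inverse_system G ?\<Lambda> (\<subseteq>) ?\<Sigma> ?Y ?\<phi>"
    unfolding SFT_ML_inverse_system_def using sft inv ml by blast
  then show ?thesis
    unfolding conjugate_to_ML_limit_of_SFTs_def using con
    by (intro exI[of _ ?\<Lambda>] exI[of _ "(\<subseteq>)"] exI[of _ ?\<Sigma>] exI[of _ ?Y] exI[of _ ?\<phi>] conjI)
qed

text \<open>The constructed presentation is indexed by clopen families with letters in
  \<open>nat\<close>, which fixes the types in the equivalence. The converse argument works for any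
  index and letter types, as the second conjunct records.\<close>

theorem corollary1p2:
  fixes G :: "('g, 'm) monoid_scheme"
    and X :: "'x topology"
    and \<Phi> :: "'g \<Rightarrow> 'x \<Rightarrow> 'x"
    and S :: "'g set"
  assumes "group G" and "countable (carrier G)"
    and "finite_generator G S"
    and "dynamical_system G X \<Phi>"
    and "totally_disconnected_space X"
  shows "(shadowing_property G X \<Phi> S \<longleftrightarrow>
            conjugate_to_ML_limit_of_SFTs TYPE('x set set) TYPE(nat) G X \<Phi>)
       \<and> (conjugate_to_ML_limit_of_SFTs TYPE('l) TYPE('a) G X \<Phi> \<longrightarrow>
            shadowing_property G X \<Phi> S)"
proof -
  interpret generated_system G X \<Phi> S
    using assms by (simp add: generated_system_def generated_system_axioms_def)
  note backward = shadowing_if_limit_of_SFTs[OF assms(1,3,4)]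
  show ?thesis
    by (intro conjI iffI impI) (fact limit_of_SFTs_if_shadowing[OF assms(5)] backward)+
qed

end
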